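(* Let $\mathcal V$ be a unital commutative associative differential superalgebra, with even derivation $\partial$ and parity $p$. The Poisson vertex superalgebra structures on $\mathcal V$ (with the given product and derivation) are in bijective correspondence with the set $$\{X\in W^{\partial,\mathrm{as}}_1(\Pi\mathcal V)_{\bar1}\ :\ [X,X]=0\},$$ where the $\lambda$-bracket corresponding to $X$ is $[a_\lambda b]=(-1)^{p(a)}X_{\lambda,-\lambda-\partial}(a,b)$, $a,b\in\mathcal V$.
   Context: $\mathbb F$ is a field of characteristic $0$. $\Pi\mathcal V$ is $\mathcal V$ with reversed parity $\bar p=p+\bar1$; the subscript $\bar1$ denotes odd elements with respect to $\bar p$. A Poisson vertex superalgebra structure on $\mathcal V$ is a parity preserving linear map $\mathcal V\otimes\mathcal V\to\mathbb F[\lambda]\otimes\mathcal V$, $a\otimes b\mapsto[a_\lambda b]$, with: sesquilinearity $[\partial a_\lambda b]=-\lambda[a_\lambda b]$, $[a_\lambda\partial b]=(\lambda+\partial)[a_\lambda b]$; skewcommutativity $[b_\lambda a]=-(-1)^{p(a)p(b)}[a_{-\lambda-\partial}b]$ ($\partial$ moved to the left); Jacobi identity $[a_\lambda[b_\mu c]]-(-1)^{p(a)p(b)}[b_\mu[a_\lambda c]]=[[a_\lambda b]_{\lambda+\mu}c]$; Leibniz rule $[a_\lambda bc]=[a_\lambda b]c+(-1)^{p(a)p(b)}b[a_\lambda c]$. For an $\mathbb F[\partial]$-module $V$ with compatible parity $\bar p$: $\mathbb F_-[\lambda_0,\dots,\lambda_k]\otimes_{\mathbb F[\partial]}V$ is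 the quotient of $\mathbb F[\lambda_0,\dots,\lambda_k]\otimes V$ by the image of $\lambda_0+\dots+\lambda_k+\partial$. $W^\partial_k(V)$, $k\ge-1$, is the superspace of linear maps $X:V^{\otimes(k+1)}\to\mathbb F_-[\lambda_0,\dots,\lambda_k]\otimes_{\mathbb F[\partial]}V$ satisfying $X_{\lambda_0,\dots,\lambda_k}(v_0,\dots,\partial v_i,\dots,v_k)=-\lambda_iX_{\lambda_0,\dots,\lambda_k}(v_0,\dots,v_k)$ and $X_{\lambda_0,\dots,\lambda_k}(v_0,\dots,v_k)=\epsilon_v(i_0,\dots,i_k)X_{\lambda_{i_0},\dots,\lambda_{i_k}}(v_{i_0},\dots,v_{i_k})$ for all permutations, where $\epsilon_v(i_0,\dots,i_k)=(-1)^M$, $M$ the number of interchanges of indices of odd $v_i$'s. $W^\partial(V)=\bigoplus_{k\ge-1}W^\partial_k(V)$ is a Lie superalgebra with $[X,Y]=X\Box Y-(-1)^{\bar p(X)\bar p(Y)}Y\Box X$, where for $X\in W^\partial_h(V)$, $Y\in W^\partial_{k-h}(V)$ $$(X\Box Y)_{\lambda_0,\dots,\lambda_k}(v_0,\dots,v_k)=\sum_{\substack{i_0<\dots<i_{k-h}\\ i_{k-h+1}<\dots<i_k}}\epsilon_v(i_0,\dots,i_k)\,X_{\lambda_{i_0}+\dots+\lambda_{i_{k-h}},\lambda_{i_{k-h+1}},\dots,\lambda_{i_k}}\big(Y_{\lambda_{i_0},\dots,\lambda_{i_{k-h}}}(v_{i_0},\dots,v_{i_{k-h}}),v_{i_{k-h+1}},\dots,v_{i_k}\big)$$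 (sum over permutations of $(0,\dots,k)$). For $k=1$ the target is identified with $\mathbb F[\lambda]\otimes V$ by putting $\lambda_0=\lambda$, $\lambda_1=-\lambda-\partial$ ($\partial$ moved to the left), giving $X_{\lambda,-\lambda-\partial}$. $W^{\partial,\mathrm{as}}_k(\Pi\mathcal V)\subset W^\partial_k(\Pi\mathcal V)$ consists of $X$ satisfying, for each $i=0,\dots,k$, $$\begin{aligned}X_{\lambda_0,\dots,\lambda_k}(a_0,\dots,b_ic_i,\dots,a_k)=&(-1)^{p(c_i)(s_{i+1,k}+k-i)}X_{\lambda_0,\dots,\lambda_i+\partial,\dots,\lambda_k}(a_0,\dots,b_i,\dots,a_k)_\to c_i\\&+(-1)^{p(b_i)(p(c_i)+s_{i+1,k}+k-i)}X_{\lambda_0,\dots,\lambda_i+\partial,\dots,\lambda_k}(a_0,\dots,c_i,\dots,a_k)_\to b_i,\end{aligned}$$ with $s_{i+1,k}=p(a_{i+1})+\dots+p(a_k)$; the arrow means that $\partial$ in $\lambda_i+\partial$ acts only on the factor to the right ($c_i$, resp. $b_i$). It is a Lie subalgebra of $W^\partial(\Pi\mathcal V)$ when summed over $k$. *)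

theory Defs
  imports
    "HOL-Library.Poly_Mapping"
    "HOL-Library.Z2"
    "HOL-Library.FuncSet"
    "HOL-Combinatorics.Permutations"
    "HOL-Computational_Algebra.Polynomial"
begin

section \<open>Differential superalgebras\<close>

text \<open>
  Parities are elements of the two-element field \<^typ>\<open>bit\<close>; a superspace is a vector space
  with a family \<open>G\<close> of subspaces, \<open>G e\<close> consisting of the homogeneous elements of parity \<open>e\<close>.
  All signs are powers of \<open>-1\<close> with exponent in \<^typ>\<open>bit\<close>.
\<close>

definition sg :: "bit \<Rightarrow> 'a::ab_group_add \<Rightarrow> 'a" where
  "sg e x = (if e = 0 then x else - x)"

locale superspace = vector_space sc
  for sc :: "'k::field \<Rightarrow> 'v::ab_group_add \<Rightarrow> 'v" +
  fixes G :: "bit \<Rightarrow> 'v set"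
  assumes subspace_G: "subspace (G e)"
    and G_inter: "G 0 \<inter> G 1 = {0}"
    and G_sum: "\<exists>a\<in>G 0. \<exists>b\<in>G 1. v = a + b"

definition hcomp :: "(bit \<Rightarrow> 'v::ab_group_add set) \<Rightarrow> bit \<Rightarrow> 'v \<Rightarrow> 'v" where
  "hcomp G e v = (THE a. a \<in> G e \<and> v - a \<in> G (e + 1))"

definition reverse_parity :: "(bit \<Rightarrow> 'v set) \<Rightarrow> (bit \<Rightarrow> 'v set)" where
  "reverse_parity G = (\<lambda>e. G (e + 1))"

text \<open>
  The ring class is only associative and non-unital, so the unit \<open>u\<close> is a parameter
  (which also admits the zero algebra); commutativity is meant in the super sense.
\<close>

locale diff_superalgebra = superspace sc G
  for sc :: "'k::field_char_0 \<Rightarrow> 'v::ring \<Rightarrow> 'v" and G :: "bit \<Rightarrow> 'v set" +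
  fixes u :: 'v and D :: "'v \<Rightarrow> 'v"
  assumes scale_mult_left: "sc c (a * b) = sc c a * b"
    and scale_mult_right: "sc c (a * b) = a * sc c b"
    and unit_left: "u * a = a"
    and unit_right: "a * u = a"
    and unit_even: "u \<in> G 0"
    and mult_parity: "\<lbrakk>a \<in> G e; b \<in> G f\<rbrakk> \<Longrightarrow> a * b \<in> G (e + f)"
    and supercommute: "\<lbrakk>a \<in> G e; b \<in> G f\<rbrakk> \<Longrightarrow> a * b = sg (e * f) (b * a)"
    and D_linear: "Vector_Spaces.linear sc sc D"
    and D_even: "a \<in> G e \<Longrightarrow> D a \<in> G e"
    and D_derivation: "D (a * b) = D a * b + a * D b"

section \<open>Polynomials with coefficients in the module\<close>

text \<open>
  Elements of \<open>F[\<lambda>\<^sub>0, \<lambda>\<^sub>1, \<dots>] \<otimes> V\<close> are finitely supported families of coefficients in \<open>V\<close>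
  indexed by monomials, a monomial being a finitely supported family of exponents.
  \<open>F[\<lambda>] \<otimes> V\<close> is \<open>V poly\<close>.
\<close>

type_synonym 'v vpoly = "(nat \<Rightarrow>\<^sub>0 nat) \<Rightarrow>\<^sub>0 'v"

definition vpolys :: "nat \<Rightarrow> 'v::ab_group_add vpoly set" where
  "vpolys n = {P. \<forall>m\<in>Poly_Mapping.keys P. Poly_Mapping.keys m \<subseteq> {..<n}}"

definition vconst :: "'v::ab_group_add \<Rightarrow> 'v vpoly" where
  "vconst v = Poly_Mapping.single 0 v"

definition lam :: "nat \<Rightarrow> 'v::ab_group_add vpoly \<Rightarrow> 'v vpoly" where
  "lam i P = (\<Sum>m\<in>Poly_Mapping.keys P.
     Poly_Mapping.single (m + Poly_Mapping.single i 1) (Poly_Mapping.lookup P m))"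

text \<open>
  Substitution of pairwise commuting operators \<open>T 0, \<dots>, T (n - 1)\<close> for the variables:
  the monomial \<open>\<lambda>\<^sub>0\<^sup>a \<lambda>\<^sub>1\<^sup>b \<dots> v\<close> becomes \<open>(T 0)\<^sup>a (T 1)\<^sup>b \<dots> (\<phi> v)\<close>.  Since the operators act on
  \<open>\<phi> v\<close>, substituting an operator involving \<open>\<partial>\<close> means that \<open>\<partial>\<close> is moved to the left
  of the coefficient.
\<close>

definition vsubst_mono :: "(nat \<Rightarrow> 'b \<Rightarrow> 'b) \<Rightarrow> nat \<Rightarrow> (nat \<Rightarrow>\<^sub>0 nat) \<Rightarrow> 'b \<Rightarrow> 'b" where
  "vsubst_mono T n m x = foldr (\<lambda>j. T j ^^ Poly_Mapping.lookup m j) [0..<n] x"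

definition vsubst ::
  "(nat \<Rightarrow> 'b \<Rightarrow> 'b) \<Rightarrow> nat \<Rightarrow> ('v::ab_group_add \<Rightarrow> 'b::ab_group_add) \<Rightarrow> 'v vpoly \<Rightarrow> 'b" where
  "vsubst T n \<phi> P =
     (\<Sum>m\<in>Poly_Mapping.keys P. vsubst_mono T n m (\<phi> (Poly_Mapping.lookup P m)))"

definition psubst ::
  "('b \<Rightarrow> 'b) \<Rightarrow> ('v::ab_group_add \<Rightarrow> 'b::ab_group_add) \<Rightarrow> 'v poly \<Rightarrow> 'b" where
  "psubst T \<phi> P = (\<Sum>n\<le>degree P. (T ^^ n) (\<phi> (coeff P n)))"

definition minus_lam_D :: "('v::ab_group_add \<Rightarrow> 'v) \<Rightarrow> 'v poly \<Rightarrow> 'v poly" where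
  "minus_lam_D D Q = - pCons 0 Q - map_poly D Q"

section \<open>Poisson vertex superalgebra structures\<close>

text \<open>
  In the Jacobi identity, an equation in \<open>F[\<lambda>, \<mu>] \<otimes> V\<close>, the variables \<open>\<lambda>\<close> and \<open>\<mu>\<close> are
  \<open>lam 0\<close> and \<open>lam 1\<close>.  Identities with signs are required for homogeneous elements and
  extend by linearity.
\<close>

definition poisson_vertex_superalgebra ::
  "('k::field_char_0 \<Rightarrow> 'v::ring \<Rightarrow> 'v) \<Rightarrow> (bit \<Rightarrow> 'v set) \<Rightarrow> ('v \<Rightarrow> 'v)
     \<Rightarrow> ('v \<Rightarrow> 'v \<Rightarrow> 'v poly) \<Rightarrow> bool" where
  "poisson_vertex_superalgebra sc G D br \<longleftrightarrow>
     \<comment> \<open>bilinear\<close>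
     (\<forall>a a' b. br (a + a') b = br a b + br a' b) \<and>
     (\<forall>a b b'. br a (b + b') = br a b + br a b') \<and>
     (\<forall>c a b. br (sc c a) b = map_poly (sc c) (br a b)) \<and>
     (\<forall>c a b. br a (sc c b) = map_poly (sc c) (br a b)) \<and>
     \<comment> \<open>parity preserving\<close>
     (\<forall>e f a b n. a \<in> G e \<and> b \<in> G f \<longrightarrow> coeff (br a b) n \<in> G (e + f)) \<and>
     \<comment> \<open>sesquilinearity\<close>
     (\<forall>a b. br (D a) b = - pCons 0 (br a b)) \<and>
     (\<forall>a b. br a (D b) = pCons 0 (br a b) + map_poly D (br a b)) \<and>
     \<comment> \<open>skewcommutativity\<close>
     (\<forall>e f a b. a \<in> G e \<and> b \<in> G f \<longrightarrow>
        br b a = - sg (e * f) (psubst (minus_lam_D D) (\<lambda>v. [:v:]) (br a b))) \<and>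
     \<comment> \<open>Jacobi identity\<close>
     (\<forall>e f g a b c. a \<in> G e \<and> b \<in> G f \<and> c \<in> G g \<longrightarrow>
        psubst (lam 1) (\<lambda>v. psubst (lam 0) vconst (br a v)) (br b c)
        - sg (e * f) (psubst (lam 0) (\<lambda>v. psubst (lam 1) vconst (br b v)) (br a c))
        = psubst (lam 0) (\<lambda>v. psubst (\<lambda>Q. lam 0 Q + lam 1 Q) vconst (br v c)) (br a b)) \<and>
     \<comment> \<open>Leibniz rule\<close>
     (\<forall>e f g a b c. a \<in> G e \<and> b \<in> G f \<and> c \<in> G g \<longrightarrow>
        br a (b * c) = map_poly (\<lambda>x. x * c) (br a b)
                       + sg (e * f) (map_poly (\<lambda>x. b * x) (br a c)))"

section \<open>The superspaces W\<close>

text \<open>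
  Everything is indexed by the number \<open>n = k + 1\<close> of arguments.  The quotient
  \<open>F\<^sub>-[\<lambda>\<^sub>0, \<dots>, \<lambda>\<^sub>k] \<otimes> V\<close> (tensor product over \<open>F[\<partial>]\<close>) is \<open>qspace D n\<close>, a set of cosets.
  Operations on the quotient are written on representatives: all maps used below send the
  image of \<open>\<lambda>\<^sub>0 + \<dots> + \<lambda>\<^sub>k + \<partial>\<close> to the corresponding image in the target, so the class of
  the result does not depend on the representatives chosen by \<open>qrep\<close>.
\<close>

definition total_op :: "('v::ab_group_add \<Rightarrow> 'v) \<Rightarrow> nat \<Rightarrow> 'v vpoly \<Rightarrow> 'v vpoly" where
  "total_op D n Q = (\<Sum>j<n. lam j Q) + Poly_Mapping.map D Q"

definition qclass :: "('v::ab_group_add \<Rightarrow> 'v) \<Rightarrow> nat \<Rightarrow> 'v vpoly \<Rightarrow> 'v vpoly set" where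
  "qclass D n P = {P + R |R. R \<in> total_op D n ` vpolys n}"

definition qspace :: "('v::ab_group_add \<Rightarrow> 'v) \<Rightarrow> nat \<Rightarrow> 'v vpoly set set" where
  "qspace D n = qclass D n ` vpolys n"

definition qrep :: "'v vpoly set \<Rightarrow> 'v vpoly" where
  "qrep C = (SOME P. P \<in> C)"

text \<open>
  The sign \<open>\<epsilon>\<^sub>v(\<sigma> 0, \<dots>, \<sigma> (n - 1))\<close>, as an exponent, for arguments of parities \<open>fs\<close>: the number
  of inversions of \<open>\<sigma>\<close> between odd arguments.
\<close>

definition eps :: "nat \<Rightarrow> bit list \<Rightarrow> (nat \<Rightarrow> nat) \<Rightarrow> bit" where
  "eps n fs \<sigma> =
     of_nat (card {(a, b). a < b \<and> b < n \<and> \<sigma> b < \<sigma> a \<and> fs ! \<sigma> a = 1 \<and> fs ! \<sigma> b = 1})"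

definition homogeneous_args :: "(bit \<Rightarrow> 'v set) \<Rightarrow> bit list \<Rightarrow> 'v list \<Rightarrow> bool" where
  "homogeneous_args G fs vs \<longleftrightarrow> list_all2 (\<lambda>f v. v \<in> G f) fs vs"

text \<open>
  Linear maps on the tensor power are multilinear functions of a list of \<open>n\<close> arguments,
  extensional outside the lists of length \<open>n\<close>.
\<close>

definition W :: "('k::field \<Rightarrow> 'v::ab_group_add \<Rightarrow> 'v) \<Rightarrow> (bit \<Rightarrow> 'v set) \<Rightarrow> ('v \<Rightarrow> 'v)
    \<Rightarrow> nat \<Rightarrow> ('v list \<Rightarrow> 'v vpoly set) set" where
  "W sc G D n = {X \<in> {vs. length vs = n} \<rightarrow>\<^sub>E qspace D n.
     \<comment> \<open>multilinear\<close>
     (\<forall>vs i a b. length vs = n \<and> i < n \<longrightarrow>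
        X (vs[i := a + b]) = qclass D n (qrep (X (vs[i := a])) + qrep (X (vs[i := b])))) \<and>
     (\<forall>vs i c a. length vs = n \<and> i < n \<longrightarrow>
        X (vs[i := sc c a]) = qclass D n (Poly_Mapping.map (sc c) (qrep (X (vs[i := a]))))) \<and>
     \<comment> \<open>sesquilinear\<close>
     (\<forall>vs i. length vs = n \<and> i < n \<longrightarrow>
        X (vs[i := D (vs ! i)]) = qclass D n (- lam i (qrep (X vs)))) \<and>
     \<comment> \<open>symmetric\<close>
     (\<forall>fs vs \<sigma>. length vs = n \<and> homogeneous_args G fs vs \<and> \<sigma> permutes {..<n} \<longrightarrow>
        X vs = qclass D n (sg (eps n fs \<sigma>)
          (vsubst (\<lambda>j. lam (\<sigma> j)) n vconst (qrep (X (map (\<lambda>j. vs ! \<sigma> j) [0..<n]))))))}"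

text \<open>
  Homogeneous of parity \<open>e\<close>; a class has parity \<open>f\<close> if it is represented by a polynomial
  with coefficients of parity \<open>f\<close>, the variables being even.
\<close>

definition W_parity ::
  "(bit \<Rightarrow> 'v::ab_group_add set) \<Rightarrow> nat \<Rightarrow> bit \<Rightarrow> ('v list \<Rightarrow> 'v vpoly set) \<Rightarrow> bool" where
  "W_parity G n e X \<longleftrightarrow>
     (\<forall>fs vs. length vs = n \<and> homogeneous_args G fs vs \<longrightarrow>
        (\<exists>P\<in>X vs. \<forall>m. Poly_Mapping.lookup P m \<in> G (e + sum_list fs)))"

definition W_zero :: "('v::ab_group_add \<Rightarrow> 'v) \<Rightarrow> nat \<Rightarrow> 'v list \<Rightarrow> 'v vpoly set" where
  "W_zero D n = (\<lambda>vs\<in>{vs. length vs = n}. qclass D n 0)"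

section \<open>The bracket\<close>

text \<open>
  Permutations \<open>\<sigma>\<close> of \<open>0, \<dots>, q + r - 1\<close> that are increasing on the first \<open>q\<close> and on the
  last \<open>r\<close> positions.
\<close>

definition unshuffles :: "nat \<Rightarrow> nat \<Rightarrow> (nat \<Rightarrow> nat) set" where
  "unshuffles q r = {\<sigma>. \<sigma> permutes {..<q + r} \<and>
     strict_mono_on {..<q} \<sigma> \<and> strict_mono_on {q..<q + r} \<sigma>}"

text \<open>
  The summand of \<open>X \<box> Y\<close> belonging to \<open>\<sigma>\<close>, without the sign, where \<open>X\<close> has \<open>a \<ge> 1\<close> and \<open>Y\<close> has
  \<open>q\<close> arguments: \<open>X\<close> is extended to the polynomial value of \<open>Y\<close> in its first argument by
  linearity over \<open>F[\<lambda>\<^sub>0, \<dots>, \<lambda>\<^sub>k]\<close>.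
\<close>

definition box_term ::
  "nat \<Rightarrow> nat \<Rightarrow> ('v::ab_group_add list \<Rightarrow> 'v vpoly set) \<Rightarrow> ('v list \<Rightarrow> 'v vpoly set)
     \<Rightarrow> (nat \<Rightarrow> nat) \<Rightarrow> 'v list \<Rightarrow> 'v vpoly" where
  "box_term a q X Y \<sigma> vs =
     vsubst (\<lambda>j. lam (\<sigma> j)) q
       (\<lambda>y. vsubst (\<lambda>j. if j = 0 then (\<lambda>Q. \<Sum>l<q. lam (\<sigma> l) Q) else lam (\<sigma> (q + j - 1)))
              a vconst (qrep (X (y # map (\<lambda>l. vs ! \<sigma> l) [q..<a + q - 1]))))
       (qrep (Y (map (\<lambda>l. vs ! \<sigma> l) [0..<q])))"

text \<open>
  The signs depend on the parities of the arguments; arbitrary arguments are decomposed into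
  homogeneous components.  If \<open>X\<close> has no arguments, the sum over unshuffles in \<open>X \<box> Y\<close> is empty.
\<close>

definition W_box ::
  "(bit \<Rightarrow> 'v::ab_group_add set) \<Rightarrow> ('v \<Rightarrow> 'v) \<Rightarrow> nat \<Rightarrow> nat
     \<Rightarrow> ('v list \<Rightarrow> 'v vpoly set) \<Rightarrow> ('v list \<Rightarrow> 'v vpoly set) \<Rightarrow> 'v list \<Rightarrow> 'v vpoly set" where
  "W_box G D a q X Y = (\<lambda>vs\<in>{vs. length vs = a + q - 1}. qclass D (a + q - 1)
     (if a = 0 then 0
      else \<Sum>fs | length fs = a + q - 1. \<Sum>\<sigma>\<in>unshuffles q (a - 1).
        sg (eps (a + q - 1) fs \<sigma>) (box_term a q X Y \<sigma> (map2 (hcomp G) fs vs))))"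

text \<open>
  The bracket of \<open>X\<close> (with \<open>a\<close> arguments, homogeneous of parity \<open>e\<close>) and \<open>Y\<close> (with \<open>q\<close>
  arguments, homogeneous of parity \<open>f\<close>).
\<close>

definition W_bracket ::
  "(bit \<Rightarrow> 'v::ab_group_add set) \<Rightarrow> ('v \<Rightarrow> 'v) \<Rightarrow> nat \<Rightarrow> bit \<Rightarrow> nat \<Rightarrow> bit
     \<Rightarrow> ('v list \<Rightarrow> 'v vpoly set) \<Rightarrow> ('v list \<Rightarrow> 'v vpoly set) \<Rightarrow> 'v list \<Rightarrow> 'v vpoly set" where
  "W_bracket G D a e q f X Y = (\<lambda>vs\<in>{vs. length vs = a + q - 1}. qclass D (a + q - 1)
     (qrep (W_box G D a q X Y vs) - sg (e * f) (qrep (W_box G D q a Y X vs))))"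

section \<open>The subspaces of maps satisfying the Leibniz rule\<close>

text \<open>
  The expression obtained from \<open>P\<close> by replacing \<open>\<lambda>\<^sub>i\<close> with \<open>\<lambda>\<^sub>i + \<partial>\<close> and multiplying by \<open>c\<close> on the
  right, where \<open>\<partial>\<close> acts on \<open>c\<close> only.
\<close>

definition arrow_mult ::
  "('v::ring \<Rightarrow> 'v) \<Rightarrow> nat \<Rightarrow> nat \<Rightarrow> 'v vpoly \<Rightarrow> 'v \<Rightarrow> 'v vpoly" where
  "arrow_mult D n i P c =
     (\<Sum>m\<in>Poly_Mapping.keys P.
        Poly_Mapping.map (\<lambda>x. Poly_Mapping.lookup P m * x)
          (vsubst_mono
             (\<lambda>j. if j = i then (\<lambda>Q. lam i Q + Poly_Mapping.map D Q) else lam j)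
             n m (vconst c)))"

text \<open>
  Here \<open>G\<close> is the parity \<open>p\<close> of the algebra, whereas the elements belong to \<open>W\<close> of the space
  with reversed parity.
\<close>

definition W_as :: "('k::field \<Rightarrow> 'v::ring \<Rightarrow> 'v) \<Rightarrow> (bit \<Rightarrow> 'v set) \<Rightarrow> ('v \<Rightarrow> 'v)
    \<Rightarrow> nat \<Rightarrow> ('v list \<Rightarrow> 'v vpoly set) set" where
  "W_as sc G D n = {X \<in> W sc (reverse_parity G) D n.
     \<forall>i fs vs pb pc b c. i < n \<and> length vs = n \<and> homogeneous_args G fs vs \<and>
         b \<in> G pb \<and> c \<in> G pc \<longrightarrow>
       (let s = (\<Sum>j\<in>{i<..<n}. fs ! j) + of_nat (n - 1 - i) in
        X (vs[i := b * c]) = qclass D n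
          (sg (pc * s) (arrow_mult D n i (qrep (X (vs[i := b]))) c)
           + sg (pb * (pc + s)) (arrow_mult D n i (qrep (X (vs[i := c]))) b)))}"

section \<open>The lambda-bracket of an element with two arguments\<close>

text \<open>
  \<open>X\<^sub>\<lambda>\<^sub>,\<^sub>-\<^sub>\<lambda>\<^sub>-\<^sub>\<partial>(a, b)\<close>: the identification of the quotient in two variables with \<open>F[\<lambda>] \<otimes> V\<close>.
\<close>

definition at_lam ::
  "('v::ab_group_add \<Rightarrow> 'v) \<Rightarrow> ('v list \<Rightarrow> 'v vpoly set) \<Rightarrow> 'v \<Rightarrow> 'v \<Rightarrow> 'v poly" where
  "at_lam D X a b =
     vsubst (\<lambda>j. if j = 0 then pCons 0 else minus_lam_D D) 2 (\<lambda>v. [:v:]) (qrep (X [a, b]))"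

definition lambda_bracket ::
  "(bit \<Rightarrow> 'v::ab_group_add set) \<Rightarrow> ('v \<Rightarrow> 'v) \<Rightarrow> ('v list \<Rightarrow> 'v vpoly set)
     \<Rightarrow> 'v \<Rightarrow> 'v \<Rightarrow> 'v poly" where
  "lambda_bracket G D X a b = (\<Sum>e\<in>UNIV. sg e (at_lam D X (hcomp G e a) b))"

end

(*
Eliminating the last variable by lambda_k = -lambda_0 - ... - lambda_(k-1) - D is a normal form
for the quotient by lambda_0 + ... + lambda_k + D.  For two arguments it turns an element X into a
map A : V x V -> V[lambda], and every condition on X into an identity for A; the Leibniz rule in
the first argument follows from the one in the second by symmetry.  For three arguments all
substitutions made by X box X become substitutions of the operators lambda_0, lambda_1 and
-lambda_0 - lambda_1 - D, whose sum is -D.  Sesquilinearity and symmetry then turn the three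
unshuffles into the three terms of the Jacobi identity, and [X, X] = 2 (X box X) vanishes iff
X box X does, the characteristic being 0.  What remains is the sign (-1)^p(a), that is,
precomposition with the parity involution of V, which exchanges the identities for A with the
axioms of a Poisson vertex superalgebra.
*)
theory Submission
  imports Defs
begin

text \<open>The coefficients form only an additive group, so all substitutions are built from
  additive operators and compared on generators. Staged elimination rests on one compatibility: if T
  + T' acts as -\<partial>, then putting \<open>\<lambda>\<^sub>1 = -\<lambda> - \<partial>\<close>
  and afterwards T for \<lambda> is the simultaneous substitution of T and T'. In X box X this
  applies twice, because \<partial> on an inner value is \<partial> on an argument of the outer map,
  where sesquilinearity makes it minus the sum of the inner variables. The symmetry of X can be
  applied to an inner value only if the parity of that value is known; hence the oddness of X is
  used before the Jacobi identity can be read off. The sign (-1)^p(a) comes from the parity shift: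
  (e + 1)(f + 1) = ef + e + f + 1, and twisting the two sides of the symmetry by f and e leaves ef +
  1, the exponent of skewcommutativity. Exponents stay sums and products in the field
  \<open>bit\<close>, so that its ring laws cancel signs; what remains is decided by cases on the
  parities.\<close>

declare add_bit_eq_xor [simp del] mult_bit_eq_and [simp del]

section \<open>Additive maps and signs\<close>

lemma additive_id: "Modules.additive (\<lambda>x. x)"
  by (simp add: Modules.additive_def)

lemma additive_comp:
  assumes "Modules.additive f" "Modules.additive g"
  shows "Modules.additive (\<lambda>x. f (g x))"
  using assms by (simp add: Modules.additive_def)

lemma additive_plus:
  assumes "Modules.additive f" "Modules.additive g"
  shows "Modules.additive (\<lambda>x. f x + g x)"
  using assms by (simp add: Modules.additive_def)

lemma additive_uminus:
  assumes "Modules.additive f"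
  shows "Modules.additive (\<lambda>x. - f x)"
  using assms by (simp add: Modules.additive_def)

lemma additive_minus:
  assumes "Modules.additive f" "Modules.additive g"
  shows "Modules.additive (\<lambda>x. f x - g x)"
  using assms by (simp add: Modules.additive_def)

lemma additive_sum:
  assumes "\<And>i. i \<in> I \<Longrightarrow> Modules.additive (f i)"
  shows "Modules.additive (\<lambda>x. \<Sum>i\<in>I. f i x)"
  using assms by (simp add: Modules.additive_def sum.distrib)

lemma additive_funpow:
  fixes f :: "'a::ab_group_add \<Rightarrow> 'a"
  assumes "Modules.additive f"
  shows "Modules.additive (f ^^ n)"
  using assms by (induction n) (simp_all add: Modules.additive_def)

lemma additive_pCons_0: "Modules.additive (pCons 0)"
  by (simp add: Modules.additive_def)

lemma additive_const_poly: "Modules.additive (\<lambda>v. [:v:])"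
  by (simp add: Modules.additive_def)

lemma additive_mult_left: "Modules.additive (\<lambda>x. a * (x :: 'a::ring))"
  and additive_mult_right: "Modules.additive (\<lambda>x. (x :: 'a::ring) * a)"
  by (simp_all add: Modules.additive_def algebra_simps)

lemma sg_0 [simp]: "sg 0 x = x" and sg_1 [simp]: "sg 1 x = - x"
  by (simp_all add: sg_def)

lemma sg_zero [simp]: "sg e 0 = 0"
  by (simp add: sg_def)

lemma additive_sg: "Modules.additive (sg e)"
  by (simp add: Modules.additive_def sg_def)

lemma additive_commutes_sg:
  assumes "Modules.additive h"
  shows "h (sg e x) = sg e (h x)"
  using additive.minus[OF assms] by (simp add: sg_def)

section \<open>Polynomials with coefficients in a module\<close>

lemma additive_single: "Modules.additive (Poly_Mapping.single m)"
  by (simp add: Modules.additive_def single_add)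

lemma poly_mapping_sum_singles:
  "P = (\<Sum>m\<in>Poly_Mapping.keys P. Poly_Mapping.single m (Poly_Mapping.lookup P m))"
  by (rule poly_mapping_eqI)
    (auto simp: lookup_sum lookup_single when_def in_keys_iff)

text \<open>Single terms generate all polynomials additively. This replaces induction whenever both
  sides are additive and the number of variables does not matter.\<close>

lemma additive_eqI_single:
  assumes "Modules.additive g" "Modules.additive h"
    and "\<And>m v. g (Poly_Mapping.single m v) = h (Poly_Mapping.single m v)"
  shows "g P = h P"
proof -
  define K where "K = Poly_Mapping.keys P"
  define v where "v = Poly_Mapping.lookup P"
  have "P = (\<Sum>m\<in>K. Poly_Mapping.single m (v m))"
    unfolding K_def v_def by (rule poly_mapping_sum_singles)
  then show ?thesis
    by (simp add: additive.sum[OF assms(1)] additive.sum[OF assms(2)] assms(3))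
qed

text \<open>The range of summation depends on P, and cancellation may shrink it. Since each
  \<open>f m\<close> kills 0, the three sums can all be taken over the union of the supports of P
  and Q.\<close>

lemma additive_sum_keys:
  assumes "\<And>m. Modules.additive (f m)"
  shows "Modules.additive (\<lambda>P. \<Sum>m\<in>Poly_Mapping.keys P. f m (Poly_Mapping.lookup P m))"
proof -
  have f0: "f m 0 = 0" for m
    by (rule additive.zero[OF assms])
  have *: "(\<Sum>m\<in>Poly_Mapping.keys P. f m (Poly_Mapping.lookup P m))
      = (\<Sum>m\<in>K. f m (Poly_Mapping.lookup P m))"
    if "finite K" "Poly_Mapping.keys P \<subseteq> K" for P K
    by (rule sum.mono_neutral_left) (use that f0 in \<open>auto simp: in_keys_iff\<close>)
  show ?thesis
  proof (rule Modules.additive.intro)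
    fix P Q :: "'a \<Rightarrow>\<^sub>0 'b"
    let ?K = "Poly_Mapping.keys P \<union> Poly_Mapping.keys Q"
    show "(\<Sum>m\<in>Poly_Mapping.keys (P + Q). f m (Poly_Mapping.lookup (P + Q) m)) =
        (\<Sum>m\<in>Poly_Mapping.keys P. f m (Poly_Mapping.lookup P m)) +
        (\<Sum>m\<in>Poly_Mapping.keys Q. f m (Poly_Mapping.lookup Q m))"
      using *[of ?K "P + Q"] *[of ?K P] *[of ?K Q] Poly_Mapping.keys_add[of P Q]
      by (simp add: lookup_add additive.add[OF assms] sum.distrib)
  qed
qed

lemma sum_keys_single:
  assumes "f m 0 = 0"
  shows "(\<Sum>k\<in>Poly_Mapping.keys (Poly_Mapping.single m v).
    f k (Poly_Mapping.lookup (Poly_Mapping.single m v) k)) = f m v"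
  using assms by auto

lemma additive_lam: "Modules.additive (lam i)"
  unfolding lam_def by (rule additive_sum_keys) (rule additive_single)

lemma lam_single: "lam i (Poly_Mapping.single m v) = Poly_Mapping.single (m + Poly_Mapping.single i 1) v"
  unfolding lam_def by (rule sum_keys_single) simp

lemma lam_commute: "lam i (lam j P) = lam j (lam i P)"
  by (rule additive_eqI_single)
    (simp_all add: additive_comp[OF additive_lam additive_lam] lam_single ac_simps)

lemma lookup_map_additive:
  assumes "Modules.additive f"
  shows "Poly_Mapping.lookup (Poly_Mapping.map f P) m = f (Poly_Mapping.lookup P m)"
  by (simp add: Poly_Mapping.map.rep_eq when_def additive.zero[OF assms])

lemma additive_map:
  assumes "Modules.additive f"
  shows "Modules.additive (Poly_Mapping.map f)"
  by standard (simp add: poly_mapping_eq_iff fun_eq_iff lookup_map_additive[OF assms] lookup_add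
      additive.add[OF assms])

lemma map_single_additive:
  assumes "Modules.additive f"
  shows "Poly_Mapping.map f (Poly_Mapping.single m v) = Poly_Mapping.single m (f v)"
  by (simp add: additive.zero[OF assms])

lemma map_lam_commute:
  assumes "Modules.additive f"
  shows "Poly_Mapping.map f (lam i P) = lam i (Poly_Mapping.map f P)"
  by (rule additive_eqI_single)
    (simp_all add: lam_single map_single_additive[OF assms]
        additive_comp[OF additive_map[OF assms] additive_lam]
      additive_comp[OF additive_lam additive_map[OF assms]] del: map_single)

lemma additive_vconst: "Modules.additive vconst"
  unfolding vconst_def by (rule additive_single)

lemma map_vconst:
  assumes "Modules.additive f"
  shows "Poly_Mapping.map f (vconst v) = vconst (f v)"
  unfolding vconst_def by (rule map_single_additive[OF assms])

section \<open>Substituting commuting operators for several variables\<close>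

lemma vsubst_mono_Suc:
  "vsubst_mono T (Suc n) m x = vsubst_mono T n m ((T n ^^ Poly_Mapping.lookup m n) x)"
  by (simp add: vsubst_mono_def)

lemma vsubst_mono_0: "vsubst_mono T 0 m x = x"
  by (simp add: vsubst_mono_def)

lemma additive_vsubst_mono:
  assumes "\<And>j. j < n \<Longrightarrow> Modules.additive (T j)"
  shows "Modules.additive (vsubst_mono T n m)"
  using assms
proof (induction n)
  case (Suc n)
  then have "Modules.additive (\<lambda>x. vsubst_mono T n m ((T n ^^ Poly_Mapping.lookup m n) x))"
    by (intro additive_comp[OF Suc.IH additive_funpow]) simp_all
  then show ?case
    by (simp add: vsubst_mono_Suc[abs_def] Modules.additive_def)
qed (simp add: vsubst_mono_0 Modules.additive_def)

lemma funpow_intertwine: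
  assumes "\<And>x. h (T x) = T' (h x)"
  shows "h ((T ^^ k) x) = (T' ^^ k) (h x)"
  by (induction k) (simp_all add: assms)

lemma vsubst_mono_intertwine:
  assumes "\<And>j x. j < n \<Longrightarrow> h (T j x) = T' j (h x)"
  shows "h (vsubst_mono T n m x) = vsubst_mono T' n m (h x)"
  using assms
  by (induction n arbitrary: x) (simp_all add: vsubst_mono_0 vsubst_mono_Suc funpow_intertwine)

lemma vsubst_mono_cong:
  assumes "\<And>j. j < n \<Longrightarrow> Poly_Mapping.lookup m j = Poly_Mapping.lookup m' j"
  shows "vsubst_mono T n m x = vsubst_mono T n m' x"
  using assms by (induction n arbitrary: x) (simp_all add: vsubst_mono_0 vsubst_mono_Suc)

text \<open>The operators are applied in a fixed order, so an additional factor \<open>T i\<close>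
  arises in the middle of the composition; commutation brings it to the front. This makes
  multiplication by a variable correspond to its operator.\<close>

lemma vsubst_mono_add_single:
  assumes "i < n" and "\<And>j k x. j < n \<Longrightarrow> k < n \<Longrightarrow> T j (T k x) = T k (T j x)"
  shows "vsubst_mono T n (m + Poly_Mapping.single i 1) x = T i (vsubst_mono T n m x)"
  using assms
proof (induction n arbitrary: x)
  case (Suc n)
  show ?case
  proof (cases "i = n")
    case True
    have "vsubst_mono T n (m + Poly_Mapping.single n 1) y = vsubst_mono T n m y" for y
      by (rule vsubst_mono_cong) (simp add: lookup_add lookup_single)
    moreover have "T n (vsubst_mono T n m y) = vsubst_mono T n m (T n y)" for y
      by (rule vsubst_mono_intertwine) (simp add: Suc.prems)
    ultimately show ?thesis
      by (simp add: True vsubst_mono_Suc lookup_add lookup_single)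
  next
    case False
    then show ?thesis
      using Suc by (simp add: vsubst_mono_Suc lookup_add lookup_single)
  qed
qed simp

lemma additive_vsubst:
  assumes "\<And>j. j < n \<Longrightarrow> Modules.additive (T j)" "Modules.additive \<phi>"
  shows "Modules.additive (vsubst T n \<phi>)"
  unfolding vsubst_def
  using assms by (intro additive_sum_keys additive_comp[OF additive_vsubst_mono])

lemma vsubst_single:
  assumes "\<And>j. j < n \<Longrightarrow> Modules.additive (T j)" "Modules.additive \<phi>"
  shows "vsubst T n \<phi> (Poly_Mapping.single m v) = vsubst_mono T n m (\<phi> v)"
  unfolding vsubst_def
  by (rule sum_keys_single)
    (simp add: additive.zero[OF additive_vsubst_mono[OF assms(1)]] additive.zero[OF assms(2)])

lemma vsubst_vconst:
  assumes "\<And>j. j < n \<Longrightarrow> Modules.additive (T j)" "Modules.additive \<phi>"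
  shows "vsubst T n \<phi> (vconst v) = \<phi> v"
proof -
  have "vsubst_mono T n 0 x = x" for x
    by (induction n) (simp_all add: vsubst_mono_0 vsubst_mono_Suc)
  then show ?thesis
    using assms by (simp add: vconst_def vsubst_single)
qed

lemma vsubst_lam:
  assumes "\<And>j. j < n \<Longrightarrow> Modules.additive (T j)" "Modules.additive \<phi>" "i < n"
    and "\<And>j k x. j < n \<Longrightarrow> k < n \<Longrightarrow> T j (T k x) = T k (T j x)"
  shows "vsubst T n \<phi> (lam i P) = T i (vsubst T n \<phi> P)"
proof (rule additive_eqI_single[of "\<lambda>P. vsubst T n \<phi> (lam i P)" "\<lambda>P. T i (vsubst T n \<phi> P)"])
  show "vsubst T n \<phi> (lam i (Poly_Mapping.single m v)) =
      T i (vsubst T n \<phi> (Poly_Mapping.single m v))" for m v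
    using assms by (simp add: lam_single vsubst_single vsubst_mono_add_single del: One_nat_def)
qed (use assms in \<open>simp_all add: additive_comp[OF additive_vsubst additive_lam]
    additive_comp[OF _ additive_vsubst]\<close>)

text \<open>Used with f the derivation or a scalar multiplication: E is the operator that f induces
  on the target, and it passes through the substitution because it commutes with every
  \<open>T j\<close>.\<close>

lemma vsubst_map:
  assumes "\<And>j. j < n \<Longrightarrow> Modules.additive (T j)" "Modules.additive \<phi>" "Modules.additive f"
      "Modules.additive E"
    and "\<And>v. \<phi> (f v) = E (\<phi> v)" "\<And>j x. j < n \<Longrightarrow> E (T j x) = T j (E x)"
  shows "vsubst T n \<phi> (Poly_Mapping.map f P) = E (vsubst T n \<phi> P)"
proof (rule additive_eqI_single[of "\<lambda>P. vsubst T n \<phi> (Poly_Mapping.map f P)" "\<lambda>P. E (vsubst T n \<phi> P)"])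
  show "vsubst T n \<phi> (Poly_Mapping.map f (Poly_Mapping.single m v))
      = E (vsubst T n \<phi> (Poly_Mapping.single m v))" for m v
    using assms by (simp add: map_single_additive vsubst_single vsubst_mono_intertwine[of n E T T])
qed (use assms in \<open>simp_all add: additive_comp[OF additive_vsubst additive_map]
    additive_comp[OF _ additive_vsubst]\<close>)

lemma vsubst_intertwine:
  assumes "Modules.additive h" "\<And>j x. j < n \<Longrightarrow> h (T j x) = T' j (h x)"
  shows "h (vsubst T n \<phi> P) = vsubst T' n (\<lambda>v. h (\<phi> v)) P"
  unfolding vsubst_def using assms
  by (simp add: additive.sum vsubst_mono_intertwine[of n h T T'])

lemma vsubst_cong:
  assumes "\<And>m. \<phi> (Poly_Mapping.lookup P m) = \<psi> (Poly_Mapping.lookup P m)" "\<And>j. j < n \<Longrightarrow> T j = T' j"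
  shows "vsubst T n \<phi> P = vsubst T' n \<psi> P"
proof -
  have "vsubst_mono T n m x = vsubst_mono T' n m x" for m x
    by (rule vsubst_mono_intertwine[of n "\<lambda>x. x"]) (simp add: assms(2))
  then show ?thesis
    by (simp add: vsubst_def assms(1))
qed

text \<open>Constants generate the polynomials in n variables under addition and multiplication by
  those variables. The bound on the variables is kept because some identities hold only for
  \<open>i < n\<close>.\<close>

lemma vpolys_induct [consumes 1, case_names vconst lam add]:
  assumes "P \<in> vpolys n"
    and vconst: "\<And>v. R (vconst v)"
    and lam: "\<And>i P. i < n \<Longrightarrow> P \<in> vpolys n \<Longrightarrow> R P \<Longrightarrow> R (lam i P)"
    and add: "\<And>P Q. P \<in> vpolys n \<Longrightarrow> Q \<in> vpolys n \<Longrightarrow> R P \<Longrightarrow> R Q \<Longrightarrow> R (P + Q)"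
  shows "R P"
proof -
  have single_in: "Poly_Mapping.single m v \<in> vpolys n" if "Poly_Mapping.keys m \<subseteq> {..<n}" for m and v :: 'a
    using that by (simp add: vpolys_def)
  have "R (Poly_Mapping.single m v)" if "Poly_Mapping.keys m \<subseteq> {..<n}" for m v
    using that
  \<comment> \<open>The induction is on the total degree; one factor
    \<open>\<lambda>\<^sub>i\<close> that occurs in the monomial is split off.\<close>
  proof (induction "\<Sum>k<n. Poly_Mapping.lookup m k" arbitrary: m rule: less_induct)
    case less
    show ?case
    proof (cases "m = 0")
      case True
      then show ?thesis
        using vconst[of v] by (simp add: vconst_def)
    next
      case False
      then obtain i where i: "Poly_Mapping.lookup m i \<noteq> 0"
        by (metis poly_mapping_eqI lookup_zero)
      with less.prems have "i < n"
        by (metis in_keys_iff lessThan_iff subsetD)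
      define m' where "m' = m - Poly_Mapping.single i 1"
      have m: "m = m' + Poly_Mapping.single i 1"
        using i by (intro poly_mapping_eqI) (auto simp: m'_def lookup_add lookup_minus lookup_single
            when_def)
      have keys: "Poly_Mapping.keys m' \<subseteq> {..<n}"
      proof
        fix k assume "k \<in> Poly_Mapping.keys m'"
        then have "k \<in> Poly_Mapping.keys m"
          by (simp add: m in_keys_iff lookup_add)
        with less.prems show "k \<in> {..<n}"
          by blast
      qed
      have "(\<Sum>k<n. Poly_Mapping.lookup m' k) < (\<Sum>k<n. Poly_Mapping.lookup m k)"
        by (rule sum_strict_mono_ex1) (use \<open>i < n\<close> in \<open>auto simp: m lookup_add lookup_single
            intro!: bexI[of _ i]\<close>)
      then show ?thesis
        using lam[OF \<open>i < n\<close> single_in[OF keys] less.hyps[OF _ keys]] by (simp add: m lam_single)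
    qed
  qed
  then have *: "R (Poly_Mapping.single m (Poly_Mapping.lookup P m)) \<and>
      Poly_Mapping.single m (Poly_Mapping.lookup P m) \<in> vpolys n" if "m \<in> Poly_Mapping.keys P" for m
    using assms(1) that single_in by (auto simp: vpolys_def)
  have zero: "R 0" "0 \<in> vpolys n"
    using vconst[of 0] by (simp_all add: vconst_def vpolys_def)
  have add_in: "Q + Q' \<in> vpolys n" if "Q \<in> vpolys n" "Q' \<in> vpolys n" for Q Q' :: "'a vpoly"
    using that Poly_Mapping.keys_add[of Q Q'] by (auto simp: vpolys_def)
  have "R (\<Sum>m\<in>K. Poly_Mapping.single m (Poly_Mapping.lookup P m)) \<and>
      (\<Sum>m\<in>K. Poly_Mapping.single m (Poly_Mapping.lookup P m)) \<in> vpolys n" if "K \<subseteq> Poly_Mapping.keys P" for K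
    using finite_subset[OF that finite_keys] that
    by (induction K rule: finite_induct) (auto simp: zero add add_in *)
  from this[of "Poly_Mapping.keys P"] show ?thesis
    by (simp flip: poly_mapping_sum_singles)
qed

section \<open>Substituting an operator for one variable\<close>

lemma map_poly_coeff:
  assumes "Modules.additive f"
  shows "coeff (map_poly f P) n = f (coeff P n)"
  by (simp add: coeff_map_poly additive.zero[OF assms])

lemma additive_map_poly:
  assumes "Modules.additive f"
  shows "Modules.additive (map_poly f)"
  by (rule Modules.additive.intro)
    (simp add: poly_eq_iff map_poly_coeff[OF assms] additive.add[OF assms])

lemma map_poly_pCons_additive:
  assumes "Modules.additive f"
  shows "map_poly f (pCons a P) = pCons (f a) (map_poly f P)"
  by (simp add: poly_eq_iff map_poly_coeff[OF assms] coeff_pCons split: nat.split)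

text \<open>Degrees may drop in a sum, so additivity needs a common bound that can exceed the actual
  degree; the additional terms vanish.\<close>

lemma psubst_extend:
  assumes "Modules.additive T" "Modules.additive \<phi>" "degree P \<le> N"
  shows "psubst T \<phi> P = (\<Sum>n\<le>N. (T ^^ n) (\<phi> (coeff P n)))"
  unfolding psubst_def using assms
  by (intro sum.mono_neutral_left)
    (auto simp: coeff_eq_0 additive.zero[OF assms(2)] additive.zero[OF additive_funpow[OF assms(1)]])

lemma additive_psubst:
  fixes \<phi> :: "'a::ab_group_add \<Rightarrow> 'b::ab_group_add"
  assumes "Modules.additive T" "Modules.additive \<phi>"
  shows "Modules.additive (psubst T \<phi>)"
proof (rule Modules.additive.intro)
  fix P Q :: "'a poly"
  let ?N = "max (degree P) (degree Q)"
  have "degree (P + Q) \<le> ?N"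
    by (rule degree_add_le_max)
  then show "psubst T \<phi> (P + Q) = psubst T \<phi> P + psubst T \<phi> Q"
    by (simp add: psubst_extend[OF assms, where N = ?N] additive.add[OF assms(2)]
        additive.add[OF additive_funpow[OF assms(1)]] sum.distrib)
qed

lemma psubst_pCons:
  assumes "Modules.additive T" "Modules.additive \<phi>"
  shows "psubst T \<phi> (pCons a P) = \<phi> a + T (psubst T \<phi> P)"
proof -
  have "degree (pCons a P) \<le> Suc (degree P)"
    by (rule degree_pCons_le)
  then have "psubst T \<phi> (pCons a P) = (\<Sum>n\<le>Suc (degree P). (T ^^ n) (\<phi> (coeff (pCons a P) n)))"
    by (rule psubst_extend[OF assms])
  also have "\<dots> = \<phi> a + T (psubst T \<phi> P)"
    by (simp add: sum.atMost_Suc_shift psubst_def additive.sum[OF assms(1)] del: sum.atMost_Suc)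
  finally show ?thesis .
qed

lemma psubst_const:
  assumes "Modules.additive T" "Modules.additive \<phi>"
  shows "psubst T \<phi> [:a:] = \<phi> a"
  by (simp add: psubst_def)

lemma psubst_pCons_0:
  assumes "Modules.additive T" "Modules.additive \<phi>"
  shows "psubst T \<phi> (pCons 0 P) = T (psubst T \<phi> P)"
  by (simp add: psubst_pCons[OF assms] additive.zero[OF assms(2)])

lemma psubst_cong:
  assumes "\<And>n. \<phi> (coeff P n) = \<psi> (coeff P n)" "T = T'"
  shows "psubst T \<phi> P = psubst T' \<psi> P"
  by (simp add: psubst_def assms)

lemma psubst_intertwine:
  assumes "Modules.additive h" "\<And>x. h (T x) = T' (h x)"
  shows "h (psubst T \<phi> P) = psubst T' (\<lambda>v. h (\<phi> v)) P"
  using assms by (simp add: psubst_def additive.sum funpow_intertwine[of h T T'])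

text \<open>Uniqueness by Horner's scheme: the values on constants and the operator T corresponding
  to multiplication by \<lambda> determine an additive map.\<close>

lemma additive_eqI_pCons:
  assumes "Modules.additive g" "Modules.additive h"
    and "\<And>v. g [:v:] = h [:v:]" "\<And>P. g (pCons 0 P) = T (g P)" "\<And>P. h (pCons 0 P) = T (h P)"
  shows "g P = h P"
proof (induction P)
  case 0
  then show ?case
    by (simp add: additive.zero[OF assms(1)] additive.zero[OF assms(2)])
next
  case (pCons a P)
  have "pCons a P = [:a:] + pCons 0 P"
    by simp
  then show ?case
    by (simp only: additive.add[OF assms(1)] additive.add[OF assms(2)] assms(3-5) pCons.IH)
qed

lemma psubst_map_poly:
  assumes "Modules.additive T" "Modules.additive \<phi>" "Modules.additive f" "Modules.additive E"
    and "\<And>v. \<phi> (f v) = E (\<phi> v)" "\<And>x. E (T x) = T (E x)"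
  shows "psubst T \<phi> (map_poly f P) = E (psubst T \<phi> P)"
  by (rule additive_eqI_pCons[where T = T and g = "\<lambda>P. psubst T \<phi> (map_poly f P)"])
    (use assms in \<open>simp_all add: additive_comp[OF additive_psubst additive_map_poly]
      additive_comp[OF assms(4) additive_psubst] map_poly_pCons_additive psubst_pCons
          additive.zero[OF assms(2)] additive.zero[OF assms(3)]
      additive.zero[OF assms(1)] additive.zero[OF additive_psubst] additive.zero[OF assms(4)]
          additive.add[OF assms(4)] psubst_const additive_map_poly\<close>)

lemma additive_minus_lam_D:
  assumes "Modules.additive D"
  shows "Modules.additive (minus_lam_D D)"
  by (rule Modules.additive.intro)
    (simp add: minus_lam_D_def additive.add[OF additive_map_poly[OF assms]])

lemma map_poly_pCons_0:
  assumes "Modules.additive f"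
  shows "map_poly f (pCons 0 P) = pCons 0 (map_poly f P)"
  by (simp add: map_poly_pCons_additive[OF assms] additive.zero[OF assms])

lemma minus_lam_D_pCons_0:
  assumes "Modules.additive D"
  shows "minus_lam_D D (pCons 0 Q) = pCons 0 (minus_lam_D D Q)"
  by (simp add: minus_lam_D_def map_poly_pCons_0[OF assms])

lemma map_poly_minus_lam_D:
  assumes "Modules.additive D"
  shows "map_poly D (minus_lam_D D Q) = minus_lam_D D (map_poly D Q)"
  by (simp add: minus_lam_D_def map_poly_pCons_0[OF assms]
      additive.diff[OF additive_map_poly[OF assms]] additive.minus[OF additive_map_poly[OF assms]])

section \<open>The two-variable identification\<close>

text \<open>The right-hand side of skewcommutativity without its sign. Under the identification of
  two variables with one it is the exchange of \<open>\<lambda>\<^sub>0\<close> and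
  \<open>\<lambda>\<^sub>1\<close>.\<close>

definition flip :: "('v::ab_group_add \<Rightarrow> 'v) \<Rightarrow> 'v poly \<Rightarrow> 'v poly" where
  "flip D Q = psubst (minus_lam_D D) (\<lambda>v. [:v:]) Q"

text \<open>The identification \<open>\<lambda>\<^sub>0 = \<lambda>\<close>, \<open>\<lambda>\<^sub>1 = -\<lambda> - \<partial>\<close> on representatives, and its section \<open>\<lambda> = \<lambda>\<^sub>0\<close>.\<close>

definition to_poly :: "('v::ab_group_add \<Rightarrow> 'v) \<Rightarrow> 'v vpoly \<Rightarrow> 'v poly" where
  "to_poly D = vsubst (\<lambda>j. if j = 0 then pCons 0 else minus_lam_D D) 2 (\<lambda>v. [:v:])"

definition of_poly :: "'v::ab_group_add poly \<Rightarrow> 'v vpoly" where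
  "of_poly = psubst (lam 0) vconst"

lemma additive_of_poly: "Modules.additive of_poly"
  unfolding of_poly_def by (intro additive_psubst additive_lam additive_vconst)

context
  fixes D :: "'v::ab_group_add \<Rightarrow> 'v"
  assumes D: "Modules.additive D"
begin

lemma additive_to_poly: "Modules.additive (to_poly D)"
  unfolding to_poly_def
  by (intro additive_vsubst) (simp_all add: additive_pCons_0 additive_minus_lam_D[OF D] additive_const_poly)

lemma to_poly_vconst: "to_poly D (vconst v) = [:v:]"
  unfolding to_poly_def
  by (intro vsubst_vconst) (simp_all add: additive_pCons_0 additive_minus_lam_D[OF D] additive_const_poly)

lemma to_poly_lam:
  shows "to_poly D (lam 0 P) = pCons 0 (to_poly D P)"
    and "to_poly D (lam 1 P) = minus_lam_D D (to_poly D P)"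
  unfolding to_poly_def
  by (subst vsubst_lam; simp add: additive_pCons_0 additive_minus_lam_D[OF D] additive_const_poly
      minus_lam_D_pCons_0[OF D])+

lemma to_poly_map: "to_poly D (Poly_Mapping.map D P) = map_poly D (to_poly D P)"
  unfolding to_poly_def
  by (intro vsubst_map) (auto simp: additive_pCons_0 additive_minus_lam_D[OF D] additive_const_poly
     additive_map_poly[OF D] D map_poly_pCons_additive[OF D] additive.zero[OF D] map_poly_minus_lam_D[OF D])

lemma to_poly_of_poly: "to_poly D (of_poly Q) = Q"
  unfolding of_poly_def
  by (rule additive_eqI_pCons[where T = "pCons 0" and g = "\<lambda>Q. to_poly D (psubst (lam 0) vconst Q)"])
   (simp_all add: psubst_const psubst_pCons_0 additive_lam additive_vconst to_poly_vconst to_poly_lam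
     additive_comp[OF additive_to_poly additive_psubst] additive_id)

text \<open>By \<open>sum\<close>, \<partial> on coefficients acts on the results as -(T + T').
  Hence -\<lambda> - \<partial> becomes T' once \<lambda> becomes T, and the two successive
  substitutions merge into one.\<close>

lemma psubst_to_poly:
  assumes T: "Modules.additive T" "Modules.additive \<phi>" "Modules.additive T'"
    and sum: "\<And>x. psubst T \<phi> (map_poly D x) = - T (psubst T \<phi> x) - T' (psubst T \<phi> x)"
  shows "psubst T \<phi> (to_poly D P) = vsubst (\<lambda>j. if j = 0 then T else T') 2 \<phi> P"
proof -
  have "psubst T \<phi> (to_poly D P) = vsubst (\<lambda>j. if j = 0 then T else T') 2 (\<lambda>v. psubst T \<phi> [:v:]) P"
    unfolding to_poly_def
  proof (rule vsubst_intertwine)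
    note a = additive_psubst[OF T(1,2)]
    show "Modules.additive (psubst T \<phi>)" by (rule a)
    show "psubst T \<phi> ((if j = 0 then pCons 0 else minus_lam_D D) x)
        = (if j = 0 then T else T') (psubst T \<phi> x)" for j x
      by (simp add: psubst_pCons_0[OF T(1,2)] minus_lam_D_def additive.minus[OF a] additive.diff[OF a]
          additive.minus[OF T(1)] sum)
  qed
  then show ?thesis
    by (simp add: psubst_const[OF T(1,2)])
qed

lemma additive_flip: "Modules.additive (flip D)"
  unfolding flip_def[abs_def]
  by (intro additive_psubst additive_minus_lam_D D additive_const_poly)

lemma flip_const: "flip D [:v:] = [:v:]"
  unfolding flip_def by (intro psubst_const additive_minus_lam_D D additive_const_poly)

lemma flip_pCons_0: "flip D (pCons 0 Q) = minus_lam_D D (flip D Q)"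
  unfolding flip_def by (intro psubst_pCons_0 additive_minus_lam_D D additive_const_poly)

lemma flip_map: "flip D (map_poly D Q) = map_poly D (flip D Q)"
  unfolding flip_def
  by (intro psubst_map_poly additive_minus_lam_D D additive_const_poly additive_map_poly)
    (simp_all add: map_poly_pCons_additive[OF D] map_poly_minus_lam_D[OF D])

lemma flip_minus_lam_D: "flip D (minus_lam_D D Q) = pCons 0 (flip D Q)"
  by (simp add: minus_lam_D_def[of D Q] additive.diff[OF additive_flip] additive.minus[OF additive_flip]
      flip_pCons_0 flip_map) (simp add: minus_lam_D_def additive.minus[OF additive_map_poly[OF D]])

text \<open>Again -\<lambda> - \<partial> is sent to T' when T + T' acts as -\<partial>, so flipping
  first amounts to using T' in place of T.\<close>

lemma psubst_flip:
  assumes T: "Modules.additive T" "Modules.additive \<phi>" "Modules.additive T'"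
    and sum: "\<And>x. psubst T \<phi> (map_poly D x) = - T (psubst T \<phi> x) - T' (psubst T \<phi> x)"
  shows "psubst T \<phi> (flip D Q) = psubst T' \<phi> Q"
proof -
  note a = additive_psubst[OF T(1,2)]
  have "psubst T \<phi> (minus_lam_D D x) = T' (psubst T \<phi> x)" for x
    by (simp add: psubst_pCons_0[OF T(1,2)] minus_lam_D_def additive.minus[OF a] additive.diff[OF a]
        additive.minus[OF T(1)] sum)
  with a show ?thesis
    unfolding flip_def by (simp add: psubst_intertwine[of "psubst T \<phi>" _ T'] psubst_const[OF T(1,2)])
qed

end

section \<open>Normal forms in the quotient\<close>

lemma zero_in_vpolys: "0 \<in> vpolys n"
  by (simp add: vpolys_def)

lemma add_in_vpolys: "P \<in> vpolys n \<Longrightarrow> Q \<in> vpolys n \<Longrightarrow> P + Q \<in> vpolys n"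
  using Poly_Mapping.keys_add[of P Q] by (auto simp: vpolys_def)

lemma uminus_in_vpolys: "P \<in> vpolys n \<Longrightarrow> - P \<in> vpolys n"
  by (auto simp: vpolys_def in_keys_iff)

lemma sum_in_vpolys: "(\<And>i. i \<in> I \<Longrightarrow> f i \<in> vpolys n) \<Longrightarrow> sum f I \<in> vpolys n"
  by (induction I rule: infinite_finite_induct) (simp_all add: zero_in_vpolys add_in_vpolys)

lemma sg_in_vpolys: "P \<in> vpolys n \<Longrightarrow> sg e P \<in> vpolys n"
  by (simp add: sg_def uminus_in_vpolys)

lemma vconst_in_vpolys: "vconst v \<in> vpolys n"
  by (simp add: vpolys_def vconst_def)

lemma lam_in_vpolys:
  assumes "i < n" "P \<in> vpolys n" shows "lam i P \<in> vpolys n"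
  unfolding lam_def
proof (rule sum_in_vpolys)
  fix m assume "m \<in> Poly_Mapping.keys P"
  with assms have "Poly_Mapping.keys (m + Poly_Mapping.single i 1) \<subseteq> {..<n}"
    using Poly_Mapping.keys_add[of m "Poly_Mapping.single i 1"] by (auto simp: vpolys_def)
  then show "Poly_Mapping.single (m + Poly_Mapping.single i 1) (Poly_Mapping.lookup P m) \<in> vpolys n"
    by (simp add: vpolys_def)
qed

lemma map_in_vpolys:
  assumes "P \<in> vpolys n" shows "Poly_Mapping.map f P \<in> vpolys n"
  using assms by (auto simp: vpolys_def in_keys_iff Poly_Mapping.map.rep_eq when_def)

lemma vsubst_mono_closed:
  assumes "\<And>j Q. j < k \<Longrightarrow> Q \<in> S \<Longrightarrow> T j Q \<in> S" "Q \<in> S"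
  shows "vsubst_mono T k m Q \<in> S"
  using assms
proof (induction k arbitrary: Q)
  case (Suc k)
  have "(T k ^^ l) Q \<in> S" for l
    by (induction l) (simp_all add: Suc.prems)
  then show ?case
    by (simp add: vsubst_mono_Suc Suc)
qed (simp add: vsubst_mono_0)

lemma sum_closed:
  assumes "0 \<in> S" "\<And>P Q. P \<in> S \<Longrightarrow> Q \<in> S \<Longrightarrow> P + Q \<in> S"
    and "\<And>i. i \<in> I \<Longrightarrow> f i \<in> S"
  shows "sum f I \<in> S"
  using assms(3) by (induction I rule: infinite_finite_induct) (simp_all add: assms(1,2))

text \<open>The set S is arbitrary so that the argument covers both the bound on the variables and
  the parity of the coefficients.\<close>

lemma vsubst_closed:
  assumes "0 \<in> S" "\<And>P Q. P \<in> S \<Longrightarrow> Q \<in> S \<Longrightarrow> P + Q \<in> S"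
    and "\<And>j Q. j < k \<Longrightarrow> Q \<in> S \<Longrightarrow> T j Q \<in> S" "\<And>m. \<phi> (Poly_Mapping.lookup P m) \<in> S"
  shows "vsubst T k \<phi> P \<in> S"
  unfolding vsubst_def using assms by (intro sum_closed vsubst_mono_closed) auto

lemma psubst_closed:
  assumes "0 \<in> S" "\<And>P Q. P \<in> S \<Longrightarrow> Q \<in> S \<Longrightarrow> P + Q \<in> S"
    and "\<And>Q. Q \<in> S \<Longrightarrow> T Q \<in> S" "\<And>n. \<phi> (coeff P n) \<in> S"
  shows "psubst T \<phi> P \<in> S"
proof -
  have "(T ^^ n) Q \<in> S" if "Q \<in> S" for n Q
    using that by (induction n) (simp_all add: assms(3))
  then show ?thesis
    unfolding psubst_def using assms by (intro sum_closed) auto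
qed

lemma vsubst_in_vpolys:
  assumes "\<And>j Q. j < k \<Longrightarrow> Q \<in> vpolys n \<Longrightarrow> T j Q \<in> vpolys n" "\<And>v. \<phi> v \<in> vpolys n"
  shows "vsubst T k \<phi> P \<in> vpolys n"
  using assms by (intro vsubst_closed zero_in_vpolys add_in_vpolys)

lemma of_poly_in_vpolys: "0 < n \<Longrightarrow> of_poly Q \<in> vpolys n"
proof (induction Q)
  case (pCons a Q)
  then show ?case
    by (simp add: of_poly_def psubst_pCons additive_lam additive_vconst add_in_vpolys vconst_in_vpolys
        lam_in_vpolys)
qed (simp add: additive.zero[OF additive_of_poly] zero_in_vpolys)

section \<open>Cosets of the image of the total operator, and their normal forms\<close>

context
  fixes D :: "'v::ab_group_add \<Rightarrow> 'v"
  assumes D: "Modules.additive D"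
begin

lemma additive_total_op: "Modules.additive (total_op D n)"
  unfolding total_op_def by (intro additive_plus additive_sum additive_lam additive_map D)

lemma total_op_lam: "total_op D n (lam i Q) = lam i (total_op D n Q)"
  by (simp add: total_op_def map_lam_commute[OF D] additive.add[OF additive_lam]
      additive.sum[OF additive_lam] lam_commute[of i])

lemma total_op_in_vpolys: "k \<le> n \<Longrightarrow> Q \<in> vpolys n \<Longrightarrow> total_op D k Q \<in> vpolys n"
  unfolding total_op_def by (intro add_in_vpolys sum_in_vpolys lam_in_vpolys map_in_vpolys) auto

lemma qclass_eq_iff: "qclass D n P = qclass D n Q \<longleftrightarrow> P - Q \<in> total_op D n ` vpolys n"
proof
  note a = additive_total_op[of n]
  have "P + 0 \<in> qclass D n P"
    unfolding qclass_def using zero_in_vpolys additive.zero[OF a]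
    by (metis (mono_tags, lifting) image_eqI mem_Collect_eq)
  moreover assume "qclass D n P = qclass D n Q"
  ultimately obtain R where "P = Q + R" "R \<in> total_op D n ` vpolys n"
    unfolding qclass_def by auto
  then show "P - Q \<in> total_op D n ` vpolys n"
    by simp
next
  note a = additive_total_op[of n]
  have *: "qclass D n P \<subseteq> qclass D n Q" if PQ: "P - Q \<in> total_op D n ` vpolys n" for P Q
  proof
    fix x assume "x \<in> qclass D n P"
    then obtain R where R: "x = P + total_op D n R" "R \<in> vpolys n"
      unfolding qclass_def by auto
    obtain S where S: "P - Q = total_op D n S" "S \<in> vpolys n"
      using PQ by auto
    have "x = Q + total_op D n (R + S)"
      using S(1) by (simp add: R(1) additive.add[OF a] algebra_simps)
    then show "x \<in> qclass D n Q"
      unfolding qclass_def using add_in_vpolys[OF R(2) S(2)] by blast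
  qed
  assume PQ: "P - Q \<in> total_op D n ` vpolys n"
  then obtain S where S: "P - Q = total_op D n S" "S \<in> vpolys n"
    by auto
  then have "Q - P = total_op D n (- S)"
    by (simp add: additive.minus[OF a] flip: S(1))
  with S(2) have "Q - P \<in> total_op D n ` vpolys n"
    by (auto intro: uminus_in_vpolys)
  with PQ * show "qclass D n P = qclass D n Q"
    by blast
qed

lemma mem_qclass_iff: "P \<in> qclass D n Q \<longleftrightarrow> qclass D n P = qclass D n Q"
proof -
  have "P \<in> qclass D n Q \<longleftrightarrow> P - Q \<in> total_op D n ` vpolys n"
    unfolding qclass_def by (auto simp: algebra_simps intro!: exI[of _ "P - Q"])
  then show ?thesis
    by (simp add: qclass_eq_iff)
qed

text \<open>A coset contains its chosen representative; nothing further is known about the choice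
  made by \<open>qrep\<close>, so all later statements pass through classes or normal forms.\<close>

lemma qclass_qrep: "qclass D n (qrep (qclass D n P)) = qclass D n P"
proof -
  have "qrep (qclass D n P) \<in> qclass D n P"
    unfolding qrep_def by (rule someI[of _ P]) (simp add: mem_qclass_iff)
  then show ?thesis
    by (simp add: mem_qclass_iff)
qed

lemma qrep_in_vpolys:
  assumes "P \<in> vpolys n"
  shows "qrep (qclass D n P) \<in> vpolys n"
proof -
  from qclass_qrep obtain Q where "Q \<in> vpolys n" "qrep (qclass D n P) - P = total_op D n Q"
    by (metis qclass_eq_iff imageE)
  then show ?thesis
    using assms add_in_vpolys[of P n "total_op D n Q"] total_op_in_vpolys[of n n Q]
    by (simp add: algebra_simps)
qed

lemma qspaceE:
  assumes "C \<in> qspace D n"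
  shows "qrep C \<in> vpolys n" "qclass D n (qrep C) = C"
  using assms by (auto simp: qspace_def qrep_in_vpolys qclass_qrep)

text \<open>A normal form modulo \<open>\<lambda>\<^sub>0 + \<dots> + \<lambda>\<^sub>n + \<partial>\<close>: the last variable is eliminated.\<close>

definition "elim_last n = vsubst (\<lambda>j. if j < n then lam j else (\<lambda>Q. - total_op D n Q)) (Suc n) vconst"

lemma additive_elim_last: "Modules.additive (elim_last n)"
  unfolding elim_last_def
  by (intro additive_vsubst) (simp_all add: additive_lam additive_vconst
      additive_uminus[OF additive_total_op])

lemma elim_last_vconst: "elim_last n (vconst v) = vconst v"
  unfolding elim_last_def
  by (intro vsubst_vconst) (simp_all add: additive_lam additive_vconst
      additive_uminus[OF additive_total_op])

lemma elim_last_lam: "i \<le> n \<Longrightarrow> elim_last n (lam i P)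
    = (if i < n then lam i (elim_last n P) else - total_op D n (elim_last n P))"
  unfolding elim_last_def
  by (subst vsubst_lam)
    (auto simp: additive_lam additive_vconst additive_uminus[OF additive_total_op] lam_commute
     additive.minus[OF additive_lam] total_op_lam)

lemma map_total_op: "Poly_Mapping.map D (total_op D n Q) = total_op D n (Poly_Mapping.map D Q)"
  by (simp add: total_op_def additive.add[OF additive_map[OF D]] additive.sum[OF additive_map[OF D]]
      map_lam_commute[OF D])

lemma elim_last_map: "elim_last n (Poly_Mapping.map D P) = Poly_Mapping.map D (elim_last n P)"
  unfolding elim_last_def
  by (intro vsubst_map)
   (auto simp: additive_lam additive_vconst additive_uminus[OF additive_total_op] D additive_map[OF D]
       map_vconst[OF D]
      map_lam_commute[OF D] additive.minus[OF additive_map[OF D]] map_total_op)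

lemma elim_last_total_op: "elim_last n (total_op D (Suc n) Q) = 0"
proof -
  have "elim_last n (total_op D (Suc n) Q) = (\<Sum>j<n. elim_last n (lam j Q)) + elim_last n (lam n Q)
      + Poly_Mapping.map D (elim_last n Q)"
    by (simp add: total_op_def additive.add[OF additive_elim_last] additive.sum[OF additive_elim_last]
        elim_last_map)
  then show ?thesis
    by (simp add: elim_last_lam) (simp add: total_op_def)
qed

lemma elim_last_in_vpolys: "elim_last n P \<in> vpolys (Suc n)"
  unfolding elim_last_def
  by (intro vsubst_in_vpolys) (auto simp: vconst_in_vpolys lam_in_vpolys uminus_in_vpolys
      total_op_in_vpolys)

text \<open>Each replacement of \<open>\<lambda>\<^sub>n\<close> by minus the sum of the other
  variables and \<partial> changes a polynomial by a value of the total operator. As that operator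
  commutes with the variables, the corrections accumulate inside its image.\<close>

lemma qclass_elim_last:
  assumes "P \<in> vpolys (Suc n)"
  shows "P - elim_last n P \<in> total_op D (Suc n) ` vpolys (Suc n)"
  using assms
proof (induction rule: vpolys_induct)
  case (vconst v)
  then show ?case
    by (intro image_eqI[of _ _ 0]) (simp_all add: elim_last_vconst zero_in_vpolys
        additive.zero[OF additive_total_op])
next
  case (lam i P)
  then obtain Q where Q: "Q \<in> vpolys (Suc n)" "P - elim_last n P = total_op D (Suc n) Q"
    by auto
  have lQ: "lam i P - lam i (elim_last n P) = total_op D (Suc n) (lam i Q)"
    using Q(2) by (simp add: total_op_lam flip: additive.diff[OF additive_lam])
  show ?case
  proof (cases "i < n")
    case True
    then show ?thesis
      using lQ lam_in_vpolys[OF lam.hyps(1) Q(1)] by (auto simp: elim_last_lam)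
  next
    case False
    then have [simp]: "i = n"
      using lam by simp
    \<comment> \<open>Multiplying the induction hypothesis by \<open>\<lambda>\<^sub>n\<close>
      leaves \<open>\<lambda>\<^sub>n\<close> times a normal form; eliminating this one factor costs
      the total operator applied to that normal form.\<close>
    have "lam i P - elim_last n (lam i P)
        = (lam i P - lam i (elim_last n P)) + total_op D (Suc n) (elim_last n P)"
      by (simp add: elim_last_lam) (simp add: total_op_def)
    also have "\<dots> = total_op D (Suc n) (lam i Q + elim_last n P)"
      by (simp only: lQ additive.add[OF additive_total_op])
    finally show ?thesis
      using add_in_vpolys[OF lam_in_vpolys[OF lam.hyps(1) Q(1)] elim_last_in_vpolys]
          by (auto simp: image_iff)
  qed
next
  case (add P Q)
  then obtain R S where "R \<in> vpolys (Suc n)" "P - elim_last n P = total_op D (Suc n) R"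
    "S \<in> vpolys (Suc n)" "Q - elim_last n Q = total_op D (Suc n) S"
    by auto
  then have "P + Q - elim_last n (P + Q) = total_op D (Suc n) (R + S)" "R + S \<in> vpolys (Suc n)"
    by (auto simp: additive.add[OF additive_total_op] additive.add[OF additive_elim_last] add_in_vpolys
        simp flip: \<open>P - elim_last n P = _\<close> \<open>Q - elim_last n Q = _\<close>)
  then show ?case
    by blast
qed

lemma qclass_eq_iff_elim_last:
  assumes "P \<in> vpolys (Suc n)" "Q \<in> vpolys (Suc n)"
  shows "qclass D (Suc n) P = qclass D (Suc n) Q \<longleftrightarrow> elim_last n P = elim_last n Q"
proof
  assume "qclass D (Suc n) P = qclass D (Suc n) Q"
  then obtain R where "P - Q = total_op D (Suc n) R"
    by (auto simp: qclass_eq_iff)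
  then have "elim_last n (P - Q) = 0"
    by (simp add: elim_last_total_op)
  then show "elim_last n P = elim_last n Q"
    by (simp add: additive.diff[OF additive_elim_last])
next
  assume "elim_last n P = elim_last n Q"
  then show "qclass D (Suc n) P = qclass D (Suc n) Q"
    using qclass_elim_last[OF assms(1)] qclass_elim_last[OF assms(2)] by (simp flip: qclass_eq_iff)
qed

text \<open>With one variable remaining, the normal form is a polynomial in
  \<open>\<lambda>\<^sub>0\<close> alone. The operators substituted for the two variables add up to
  -\<partial>, so \<open>psubst_to_poly\<close> applies.\<close>

lemma elim_last_1: "elim_last 1 P = of_poly (to_poly D P)"
proof -
  have "of_poly (to_poly D P) = vsubst (\<lambda>j. if j = 0 then lam 0 else (\<lambda>Q. - total_op D 1 Q)) 2 vconst P"
    unfolding of_poly_def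
  proof (rule psubst_to_poly[OF D])
    have "psubst (lam 0) vconst (map_poly D x) = Poly_Mapping.map D (psubst (lam 0) vconst x)" for x
      by (rule psubst_map_poly) (simp_all add: additive_lam additive_vconst D additive_map[OF D]
          map_vconst[OF D] map_lam_commute[OF D])
    then show "psubst (lam 0) vconst (map_poly D x) =
        - lam 0 (psubst (lam 0) vconst x) - (- total_op D 1 (psubst (lam 0) vconst x))" for x
      by (simp add: total_op_def)
  qed (simp_all add: additive_lam additive_vconst additive_uminus[OF additive_total_op] total_op_lam
      additive.minus[OF additive_lam])
  moreover have "(\<lambda>j. if j < 1 then lam j else (\<lambda>Q. - total_op D 1 Q)) =
      (\<lambda>j. if j = 0 then lam 0 else (\<lambda>Q. - total_op D 1 Q))"
    by (rule ext) simp
  ultimately show ?thesis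
    by (simp add: elim_last_def numeral_2_eq_2 del: One_nat_def)
qed

lemma qclass_eq_iff_to_poly:
  assumes "P \<in> vpolys 2" "Q \<in> vpolys 2"
  shows "qclass D 2 P = qclass D 2 Q \<longleftrightarrow> to_poly D P = to_poly D Q"
  using qclass_eq_iff_elim_last[of P 1 Q] assms to_poly_of_poly[OF D]
  by (metis Suc_1 elim_last_1)

end

section \<open>Superspaces and signs\<close>

lemma bit_add_self [simp]: "e + (e + f) = f" "e + e = 0" for e f :: bit
  by (cases e; cases f; simp)+

lemma UNIV_bit: "(UNIV :: bit set) = {0, 1}"
  by (auto simp: bit_not_zero_iff)

text \<open>The sign (-1)^p(v) as an additive operator on all of V, so that the sign in the bracket
  also makes sense for inhomogeneous elements.\<close>

definition par_inv :: "(bit \<Rightarrow> 'v::ab_group_add set) \<Rightarrow> 'v \<Rightarrow> 'v" where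
  "par_inv G v = hcomp G 0 v - hcomp G 1 v"

context superspace
begin

lemma G_inter_add_1: "G e \<inter> G (e + 1) = {0}"
  using G_inter by (cases e) (auto simp: Int_commute)

lemma zero_in_G: "0 \<in> G e"
  by (rule subspace_0[OF subspace_G])

lemma add_in_G: "a \<in> G e \<Longrightarrow> b \<in> G e \<Longrightarrow> a + b \<in> G e"
  by (rule subspace_add[OF subspace_G])

lemma diff_in_G: "a \<in> G e \<Longrightarrow> b \<in> G e \<Longrightarrow> a - b \<in> G e"
  by (rule subspace_diff[OF subspace_G])

lemma uminus_in_G: "a \<in> G e \<Longrightarrow> - a \<in> G e"
  by (rule subspace_neg[OF subspace_G])

lemma scale_in_G: "a \<in> G e \<Longrightarrow> sc c a \<in> G e"
  by (rule subspace_scale[OF subspace_G])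

lemma hcomp_eqI:
  assumes "a \<in> G e" "v - a \<in> G (e + 1)"
  shows "hcomp G e v = a"
  unfolding hcomp_def
proof (rule the_equality)
  fix b assume b: "b \<in> G e \<and> v - b \<in> G (e + 1)"
  then have "b - a \<in> G e" "(v - a) - (v - b) \<in> G (e + 1)"
    using assms diff_in_G by blast+
  then have "b - a \<in> G e \<inter> G (e + 1)"
    by simp
  then show "b = a"
    unfolding G_inter_add_1 by simp
qed (use assms in simp)

lemma hcomp:
  shows hcomp_in: "hcomp G e v \<in> G e" and hcomp_compl: "v - hcomp G e v \<in> G (e + 1)"
proof -
  obtain a b where ab: "a \<in> G 0" "b \<in> G 1" "v = a + b"
    using G_sum by blast
  have "hcomp G 0 v = a" "hcomp G 1 v = b"
    by (rule hcomp_eqI; use ab in simp)+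
  with ab show "hcomp G e v \<in> G e" "v - hcomp G e v \<in> G (e + 1)"
    by (cases e; simp)+
qed

lemma hcomp_homogeneous:
  assumes "a \<in> G e"
  shows "hcomp G f a = (if f = e then a else 0)"
  using assms by (auto intro!: hcomp_eqI zero_in_G)
      (metis bit_not_one_iff add.right_neutral bit_add_self(2) add_0 bit_not_zero_iff)

lemma hcomp_sum: "hcomp G 0 v + hcomp G 1 v = v"
proof -
  have "hcomp G 1 v = v - hcomp G 0 v"
    using hcomp_in[of 0 v] hcomp_compl[of v 0] by (intro hcomp_eqI) simp_all
  then show ?thesis
    by simp
qed

lemma hcomp_commute:
  assumes "Modules.additive f" "\<And>e a. a \<in> G e \<Longrightarrow> f a \<in> G e"
  shows "hcomp G e (f v) = f (hcomp G e v)"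
  by (intro hcomp_eqI) (simp_all add: assms(2) hcomp_in hcomp_compl flip: additive.diff[OF assms(1)])

lemma additive_hcomp: "Modules.additive (hcomp G e)"
proof (rule Modules.additive.intro, rule hcomp_eqI)
  fix v w
  show "hcomp G e v + hcomp G e w \<in> G e"
    by (intro add_in_G hcomp_in)
  have "(v - hcomp G e v) + (w - hcomp G e w) \<in> G (e + 1)"
    by (intro add_in_G hcomp_compl)
  then show "v + w - (hcomp G e v + hcomp G e w) \<in> G (e + 1)"
    by (simp add: algebra_simps)
qed

lemma additive_par_inv: "Modules.additive (par_inv G)"
  unfolding par_inv_def by (intro additive_minus additive_hcomp)

lemma par_inv_homogeneous: "a \<in> G e \<Longrightarrow> par_inv G a = sg e a"
  by (cases e) (simp_all add: par_inv_def hcomp_homogeneous)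

lemma par_inv_par_inv: "par_inv G (par_inv G v) = v"
proof -
  have "par_inv G (par_inv G v) = hcomp G 0 v + hcomp G 1 v"
    by (simp add: par_inv_def[of G v] additive.diff[OF additive_par_inv]
        par_inv_homogeneous[OF hcomp_in])
  then show ?thesis
    by (simp add: hcomp_sum)
qed

lemma par_inv_commute:
  assumes "Modules.additive f" "\<And>e a. a \<in> G e \<Longrightarrow> f a \<in> G e"
  shows "par_inv G (f v) = f (par_inv G v)"
  by (simp add: par_inv_def hcomp_commute[OF assms] additive.diff[OF assms(1)])

lemma superspace_reverse_parity: "superspace sc (reverse_parity G)"
proof
  show "subspace (reverse_parity G e)" for e
    by (simp add: reverse_parity_def subspace_G)
  show "reverse_parity G 0 \<inter> reverse_parity G 1 = {0}"
    using G_inter_add_1[of 1] by (simp add: reverse_parity_def)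
  show "\<exists>a\<in>reverse_parity G 0. \<exists>b\<in>reverse_parity G 1. v = a + b" for v
    using G_sum[of v] by (auto simp: reverse_parity_def) (metis add.commute)
qed

lemma additive_scale: "Modules.additive (sc c)"
  by (rule Modules.additive.intro) (rule scale_right_distrib)

end

section \<open>Permutations of two and three indices and their signs\<close>

lemma all_length_2: "(\<forall>vs. length vs = 2 \<longrightarrow> P vs) \<longleftrightarrow> (\<forall>a b. P [a, b])"
  by (auto simp: numeral_2_eq_2 length_Suc_conv)

lemma permutes_lessThan_2: "\<sigma> permutes {..<2::nat} \<longleftrightarrow> \<sigma> = id \<or> \<sigma> = Transposition.transpose 0 1"
proof
  assume p: "\<sigma> permutes {..<2}"
  have "\<sigma> 0 < 2" "\<sigma> 1 < 2"
    using permutes_in_image[OF p] by auto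
  moreover have "\<sigma> 0 \<noteq> \<sigma> 1"
    using permutes_inj[OF p] by (simp add: inj_eq)
  ultimately have "\<sigma> 0 = 0 \<and> \<sigma> 1 = 1 \<or> \<sigma> 0 = 1 \<and> \<sigma> 1 = 0"
    by linarith
  moreover have "\<sigma> i = i" if "\<not> i < 2" for i
    using permutes_not_in[OF p] that by simp
  ultimately have "(\<forall>i. \<sigma> i = i) \<or> (\<forall>i. \<sigma> i = Transposition.transpose 0 1 i)"
    by (metis (no_types, opaque_lifting) less_2_cases One_nat_def transpose_apply_first
        transpose_apply_other transpose_apply_second)
  then show "\<sigma> = id \<or> \<sigma> = Transposition.transpose 0 1"
    by (auto simp: fun_eq_iff)
qed (auto intro: permutes_id permutes_swap_id)

text \<open>Such a permutation is determined by the index in the last place. The value sequences are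
  (0, 1, 2), (0, 2, 1) and (1, 2, 0).\<close>

lemma unshuffles_2_1:
  "unshuffles 2 1 = {id, Transposition.transpose 1 2,
      Transposition.transpose 0 2 \<circ> Transposition.transpose 0 1}"
proof (intro set_eqI iffI)
  fix \<sigma> assume "\<sigma> \<in> unshuffles 2 1"
  then have p: "\<sigma> permutes {..<3}" and "\<sigma> 0 < \<sigma> 1"
    by (auto simp: unshuffles_def strict_mono_on_def numeral_3_eq_3 numeral_2_eq_2)
  have "\<sigma> 0 < 3" "\<sigma> 1 < 3" "\<sigma> 2 < 3"
    using permutes_in_image[OF p] by auto
  moreover have "\<sigma> 0 \<noteq> \<sigma> 2" "\<sigma> 1 \<noteq> \<sigma> 2"
    using permutes_inj[OF p] by (simp_all add: inj_eq)
  ultimately have v: "\<sigma> 0 = 0 \<and> \<sigma> 1 = 1 \<and> \<sigma> 2 = 2 \<or> \<sigma> 0 = 0 \<and> \<sigma> 1 = 2 \<and> \<sigma> 2 = 1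
      \<or> \<sigma> 0 = 1 \<and> \<sigma> 1 = 2 \<and> \<sigma> 2 = 0"
    using \<open>\<sigma> 0 < \<sigma> 1\<close> by linarith
  have o: "\<sigma> i = i" if "i \<noteq> 0" "i \<noteq> 1" "i \<noteq> 2" for i
    using permutes_not_in[OF p, of i] that by simp
  have ext: "\<sigma> = \<tau>" if "\<sigma> 0 = \<tau> 0" "\<sigma> 1 = \<tau> 1" "\<sigma> 2 = \<tau> 2" "\<And>i. i \<noteq> 0 \<Longrightarrow> i \<noteq> 1 \<Longrightarrow> i \<noteq> 2 \<Longrightarrow> \<tau> i = i" for \<tau>
  proof
    show "\<sigma> i = \<tau> i" for i
      using that o[of i] by (cases "i = 0"; cases "i = 1"; cases "i = 2") simp_all
  qed
  from v show "\<sigma> \<in> {id, Transposition.transpose 1 2,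
      Transposition.transpose 0 2 \<circ> Transposition.transpose 0 1}"
    using ext[of id] ext[of "Transposition.transpose 1 2"]
        ext[of "Transposition.transpose 0 2 \<circ> Transposition.transpose 0 1"]
    by (auto simp: Transposition.transpose_def)
next
  have "strict_mono_on {..<2} \<sigma>" if "\<sigma> 0 < \<sigma> 1" for \<sigma> :: "nat \<Rightarrow> nat"
    using that by (auto simp: strict_mono_on_def numeral_2_eq_2 less_Suc_eq)
  moreover have "strict_mono_on {2..<3} \<sigma>" for \<sigma> :: "nat \<Rightarrow> nat"
    by (auto simp: strict_mono_on_def)
  moreover have "Transposition.transpose a b permutes {..<3}" if "a < 3" "b < 3" for a b :: nat
    using that by (intro permutes_swap_id) auto
  moreover fix \<sigma> assume "\<sigma> \<in> {id, Transposition.transpose 1 2, Transposition.transpose 0 2 \<circ>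
      Transposition.transpose 0 (1::nat)}"
  ultimately show "\<sigma> \<in> unshuffles 2 1"
    by (auto simp: unshuffles_def permutes_id Transposition.transpose_def intro!: permutes_compose)
qed

text \<open>Counting modulo 2 is summing in \<open>bit\<close>, and the product of two parities is 1
  exactly if both are odd. In this form the sign of an explicit permutation is a polynomial in the
  parities.\<close>

lemma eps_eq_sum:
  "eps n fs \<sigma> = (\<Sum>b<n. \<Sum>a<b. if \<sigma> b < \<sigma> a then fs ! \<sigma> a * fs ! \<sigma> b else 0)"
proof -
  let ?P = "\<lambda>b a. \<sigma> b < \<sigma> a \<and> fs ! \<sigma> a = 1 \<and> fs ! \<sigma> b = 1"
  have "{(a, b). a < b \<and> b < n \<and> \<sigma> b < \<sigma> a \<and> fs ! \<sigma> a = 1 \<and> fs ! \<sigma> b = 1}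
      = prod.swap ` (SIGMA b:{..<n}. {a\<in>{..<b}. ?P b a})"
    by (auto simp: image_iff)
  then have "eps n fs \<sigma> = of_nat (card (SIGMA b:{..<n}. {a\<in>{..<b}. ?P b a}))"
    unfolding eps_def by (simp add: card_image)
  also have "\<dots> = (\<Sum>b<n. \<Sum>a<b. if ?P b a then 1 else 0)"
    by (simp add: card_SigmaI of_nat_sum sum.If_cases Int_def)
  also have "\<dots> = (\<Sum>b<n. \<Sum>a<b. if \<sigma> b < \<sigma> a then fs ! \<sigma> a * fs ! \<sigma> b else 0)"
    by (intro sum.cong refl) (auto simp: bit_not_one_iff)
  finally show ?thesis .
qed

lemma eps_2_transpose: "eps 2 [e, f] (Transposition.transpose 0 1) = e * f"
  by (simp add: eps_eq_sum numeral_2_eq_2 lessThan_Suc Transposition.transpose_def mult.commute)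

lemma eps_id: "eps n fs id = 0"
  by (auto simp: eps_eq_sum intro!: sum.neutral)

lemma eps_3:
  "eps 3 [e, f, g] (Transposition.transpose 1 2) = f * g"
  "eps 3 [e, f, g] (Transposition.transpose 0 2 \<circ> Transposition.transpose 0 1) = e * (f + g)"
  by (simp_all add: eps_eq_sum numeral_3_eq_3 numeral_2_eq_2 lessThan_Suc Transposition.transpose_def
      algebra_simps)

lemma homogeneous_args_2: "homogeneous_args G fs [a, b] \<longleftrightarrow> (\<exists>e f. fs = [e, f] \<and> a \<in> G e \<and> b \<in> G f)"
  by (auto simp: homogeneous_args_def list_all2_Cons2)

lemma sum_UNIV_bit: "(\<Sum>e\<in>UNIV. f (e::bit)) = f 0 + f 1"
  by (simp add: UNIV_bit)

section \<open>Permuting variables and multiplying by an element\<close>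

lemma at_lam_eq_to_poly: "at_lam D X a b = to_poly D (qrep (X [a, b]))"
  by (simp add: at_lam_def to_poly_def)

text \<open>Both sides of the second equation substitute -\<lambda> - \<partial> for
  \<open>\<lambda>\<^sub>0\<close> and \<lambda> for \<open>\<lambda>\<^sub>1\<close>; for the side
  with \<open>flip\<close> this is \<open>psubst_to_poly\<close>, since these operators again add up
  to -\<partial>.\<close>

lemma to_poly_permute:
  assumes D: "Modules.additive D"
  shows "to_poly D (vsubst (\<lambda>j. lam (id j)) 2 vconst P) = to_poly D P"
    and "to_poly D (vsubst (\<lambda>j. lam (Transposition.transpose 0 1 j)) 2 vconst P) = flip D (to_poly D P)"
proof -
  let ?S = "\<lambda>j::nat. if j = 0 then pCons 0 else minus_lam_D D"
  have *: "to_poly D (vsubst (\<lambda>j. lam (\<sigma> j)) 2 vconst P) = vsubst (\<lambda>j. ?S (\<sigma> j)) 2 (\<lambda>v. [:v:]) P"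
    if "\<And>j. j < 2 \<Longrightarrow> \<sigma> j < 2" for \<sigma>
  proof -
    have "to_poly D (lam i Q) = ?S i (to_poly D Q)" if "i < 2" for i Q
      using that to_poly_lam[OF D] by (auto simp: less_2_cases_iff)
    then have "to_poly D (vsubst (\<lambda>j. lam (\<sigma> j)) 2 vconst P)
        = vsubst (\<lambda>j. ?S (\<sigma> j)) 2 (\<lambda>v. to_poly D (vconst v)) P"
      using that by (intro vsubst_intertwine additive_to_poly D) blast
    then show ?thesis
      by (simp add: to_poly_vconst[OF D])
  qed
  show "to_poly D (vsubst (\<lambda>j. lam (id j)) 2 vconst P) = to_poly D P"
    using *[of id] by (simp add: to_poly_def)
  have "flip D (to_poly D P) = vsubst (\<lambda>j. if j = 0 then minus_lam_D D else pCons 0) 2 (\<lambda>v. [:v:]) P"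
    unfolding flip_def
  proof (rule psubst_to_poly[OF D])
    show "psubst (minus_lam_D D) (\<lambda>v. [:v:]) (map_poly D x) =
        - minus_lam_D D (psubst (minus_lam_D D) (\<lambda>v. [:v:]) x)
        - pCons 0 (psubst (minus_lam_D D) (\<lambda>v. [:v:]) x)" for x
      using flip_map[OF D, of x] by (simp add: flip_def minus_lam_D_def)
  qed (simp_all add: additive_minus_lam_D[OF D] additive_const_poly additive_pCons_0
      minus_lam_D_pCons_0[OF D])
  also have "\<dots> = vsubst (\<lambda>j. ?S (Transposition.transpose 0 1 j)) 2 (\<lambda>v. [:v:]) P"
    by (rule vsubst_cong) (auto simp: less_2_cases_iff)
  also have "\<dots> = to_poly D (vsubst (\<lambda>j. lam (Transposition.transpose 0 1 j)) 2 vconst P)"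
    by (rule *[symmetric]) (auto simp: less_2_cases_iff)
  finally show "to_poly D (vsubst (\<lambda>j. lam (Transposition.transpose 0 1 j)) 2 vconst P)
      = flip D (to_poly D P)" ..
qed

section \<open>Right multiplication in the arrow convention\<close>

lemma additive_arrow_mult:
  assumes D: "Modules.additive D"
  shows "Modules.additive (\<lambda>P. arrow_mult D n i P c)"
  unfolding arrow_mult_def
proof (rule additive_sum_keys)
  fix m
  have "Poly_Mapping.map (\<lambda>x. (a + b) * x) Q = Poly_Mapping.map (\<lambda>x. a * x) Q
      + Poly_Mapping.map (\<lambda>x. b * x) Q"
    for a b :: 'a and Q :: "'a vpoly"
    by (rule poly_mapping_eqI) (simp add: Poly_Mapping.map.rep_eq when_def lookup_add distrib_right)
  then show "Modules.additive (\<lambda>a. Poly_Mapping.map (\<lambda>x. a * x)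
      (vsubst_mono (\<lambda>j. if j = i then (\<lambda>Q. lam i Q + Poly_Mapping.map D Q) else lam j) n m (vconst c)))"
    by (simp add: Modules.additive_def)
qed

lemma arrow_mult_single:
  "arrow_mult D n i (Poly_Mapping.single m v) c = Poly_Mapping.map (\<lambda>x. v * x)
      (vsubst_mono (\<lambda>j. if j = i then (\<lambda>Q. lam i Q + Poly_Mapping.map D Q) else lam j) n m (vconst c))"
  unfolding arrow_mult_def
  by (rule sum_keys_single) (simp add: poly_mapping_eq_iff fun_eq_iff Poly_Mapping.map.rep_eq when_def)

lemma arrow_mult_vconst: "arrow_mult D n i (vconst v) c = vconst (v * c)"
proof -
  have "vsubst_mono T n 0 x = x" for T and x :: "'a vpoly"
    by (induction n) (simp_all add: vsubst_mono_0 vsubst_mono_Suc)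
  then show ?thesis
    by (simp add: vconst_def arrow_mult_single)
qed

text \<open>The derivation acting on the right factor only is its action on the whole product minus
  its action on the coefficient: v \<partial>x = \<partial>(v x) - (\<partial>v) x. The subtracted
  term brings the coefficientwise derivative of P into the recursion.\<close>

lemma arrow_mult_lam:
  assumes D: "Modules.additive D" and derivation: "\<And>a b. D (a * b) = D a * b + a * D b"
    and j: "j < n" "i < n"
  shows "arrow_mult D n i (lam j P) c = (if j = i
     then lam i (arrow_mult D n i P c) + Poly_Mapping.map D (arrow_mult D n i P c)
         - arrow_mult D n i (Poly_Mapping.map D P) c
     else lam j (arrow_mult D n i P c))"
proof -
  let ?T = "\<lambda>j. if j = i then (\<lambda>Q. lam i Q + Poly_Mapping.map D Q) else lam j"
  note a = additive_arrow_mult[OF D, of n i c]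
  have comm: "?T k (?T l Q) = ?T l (?T k Q)" for k l Q
    by (auto simp: lam_commute additive.add[OF additive_lam] additive.add[OF additive_map[OF D]]
        map_lam_commute[OF D])
  have mono: "vsubst_mono ?T n (m + Poly_Mapping.single j 1) x = ?T j (vsubst_mono ?T n m x)" for m x
    by (rule vsubst_mono_add_single[OF j(1)]) (rule comm)
  have map: "Poly_Mapping.map (\<lambda>x. v * x) (Poly_Mapping.map D Q) =
      Poly_Mapping.map D (Poly_Mapping.map (\<lambda>x. v * x) Q) - Poly_Mapping.map (\<lambda>x. D v * x) Q" for v Q
    by (rule poly_mapping_eqI)
      (simp add: lookup_map_additive[OF additive_mult_left] lookup_map_additive[OF D] lookup_minus
          derivation)
  show ?thesis
  proof (cases "j = i")
    case True
    have "arrow_mult D n i (lam i P) c = lam i (arrow_mult D n i P c)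
        + Poly_Mapping.map D (arrow_mult D n i P c) - arrow_mult D n i (Poly_Mapping.map D P) c"
    proof (rule additive_eqI_single[of "\<lambda>P. arrow_mult D n i (lam i P) c"
          "\<lambda>P. lam i (arrow_mult D n i P c) + Poly_Mapping.map D (arrow_mult D n i P c)
              - arrow_mult D n i (Poly_Mapping.map D P) c"])
      show "arrow_mult D n i (lam i (Poly_Mapping.single m v)) c =
        lam i (arrow_mult D n i (Poly_Mapping.single m v) c)
        + Poly_Mapping.map D (arrow_mult D n i (Poly_Mapping.single m v) c)
        - arrow_mult D n i (Poly_Mapping.map D (Poly_Mapping.single m v)) c" for m v
        using True mono[of m "vconst c"]
        by (simp add: lam_single arrow_mult_single map_single_additive[OF D] map
            additive.add[OF additive_map[OF additive_mult_left]] map_lam_commute[OF additive_mult_left]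
            del: One_nat_def map_single)
    qed (intro additive_minus additive_plus additive_comp[OF additive_lam a]
        additive_comp[OF a additive_lam]
        additive_comp[OF a additive_map[OF D]] additive_comp[OF additive_map[OF D] a])+
    with True show ?thesis by simp
  next
    case False
    have "arrow_mult D n i (lam j P) c = lam j (arrow_mult D n i P c)"
    proof (rule additive_eqI_single[of "\<lambda>P. arrow_mult D n i (lam j P) c"
        "\<lambda>P. lam j (arrow_mult D n i P c)"])
      show "arrow_mult D n i (lam j (Poly_Mapping.single m v)) c
          = lam j (arrow_mult D n i (Poly_Mapping.single m v) c)" for m v
        using False mono[of m "vconst c"]
        by (simp add: lam_single arrow_mult_single map_lam_commute[OF additive_mult_left] del: One_nat_def)
    qed (intro additive_comp[OF additive_lam a] additive_comp[OF a additive_lam])+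
    with False show ?thesis by simp
  qed
qed

lemma arrow_mult_in_vpolys:
  assumes "i < n"
  shows "arrow_mult D n i P c \<in> vpolys n"
  unfolding arrow_mult_def using assms
  by (intro sum_in_vpolys map_in_vpolys vsubst_mono_closed vconst_in_vpolys)
    (auto intro: add_in_vpolys lam_in_vpolys map_in_vpolys)

text \<open>The recursion in \<open>\<lambda>\<^sub>i\<close> involves \<open>\<partial>\<close> of the coefficients, so the induction runs over all
  \<open>\<partial>\<close>-derivatives of \<open>P\<close> at once.\<close>

lemma vpolys_2_eqI:
  assumes D: "Modules.additive D" and g: "Modules.additive g" and h: "Modules.additive h"
    and const: "\<And>v. g (vconst v) = h (vconst v)"
    and ij: "{i, j} = {0, 1::nat}"
    and g_lam: "\<And>P. g (lam j P) = U (g P)" "\<And>P. g (lam i P) = V (g P) - g (Poly_Mapping.map D P)"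
    and h_lam: "\<And>P. h (lam j P) = U (h P)" "\<And>P. h (lam i P) = V (h P) - h (Poly_Mapping.map D P)"
    and P: "P \<in> vpolys 2"
  shows "g P = h P"
proof -
  have "\<forall>n. g ((Poly_Mapping.map D ^^ n) P) = h ((Poly_Mapping.map D ^^ n) P)"
    using P
  proof (induction rule: vpolys_induct)
    case (vconst v)
    have "(Poly_Mapping.map D ^^ n) (vconst v) = vconst ((D ^^ n) v)" for n
      by (induction n) (simp_all add: map_vconst[OF D])
    then show ?case
      by (simp add: const)
  next
    case (lam k P)
    have "(Poly_Mapping.map D ^^ n) (lam k P) = lam k ((Poly_Mapping.map D ^^ n) P)" for n
      by (induction n) (simp_all add: map_lam_commute[OF D])
    moreover have "g (Poly_Mapping.map D ((Poly_Mapping.map D ^^ n) P))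
        = h (Poly_Mapping.map D ((Poly_Mapping.map D ^^ n) P))" for n
      using lam.IH[rule_format, of "Suc n"] by simp
    moreover have "k = i \<or> k = j"
      using lam.hyps ij by (auto simp: less_2_cases_iff doubleton_eq_iff)
    ultimately show ?case
      using lam.IH by (auto simp: g_lam h_lam)
  next
    case (add P Q)
    then show ?case
      by (simp add: additive.add[OF additive_funpow[OF additive_map[OF D]]] additive.add[OF g]
          additive.add[OF h])
  qed
  then show ?thesis
    by (metis funpow_0)
qed

definition rmult_poly :: "'v::ring \<Rightarrow> 'v poly \<Rightarrow> 'v poly" where
  "rmult_poly c Q = map_poly (\<lambda>x. x * c) Q"

lemma additive_rmult_poly: "Modules.additive (rmult_poly c)"
  unfolding rmult_poly_def by (rule additive_map_poly) (rule additive_mult_right)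

lemma rmult_poly_pCons: "rmult_poly c (pCons v Q) = pCons (v * c) (rmult_poly c Q)"
  unfolding rmult_poly_def by (rule map_poly_pCons_additive) (rule additive_mult_right)

lemma rmult_poly_minus_lam_D:
  assumes D: "Modules.additive D"
  shows "rmult_poly c (minus_lam_D D Q) = - pCons 0 (rmult_poly c Q) - rmult_poly c (map_poly D Q)"
  by (simp add: minus_lam_D_def additive.diff[OF additive_rmult_poly] additive.minus[OF additive_rmult_poly]
      rmult_poly_pCons)

text \<open>After the identification, \<open>\<lambda>\<^sub>1\<close> plus the derivation on c is
  -\<lambda> minus the derivation on the old coefficient alone. So c can be multiplied in at the
  end. In the other variable the same happens after exchanging the two variables, which gives the
  conjugation by \<open>flip\<close>.\<close>

lemma to_poly_arrow_mult:
  assumes D: "Modules.additive D" and derivation: "\<And>a b. D (a * b) = D a * b + a * D b"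
      and P: "P \<in> vpolys 2"
  shows "to_poly D (arrow_mult D 2 1 P c) = rmult_poly c (to_poly D P)"
    and "to_poly D (arrow_mult D 2 0 P c) = flip D (rmult_poly c (flip D (to_poly D P)))"
proof -
  note tp = additive_to_poly[OF D]
  have neg: "pCons 0 Q + map_poly D Q = - minus_lam_D D Q" "minus_lam_D D (- Q) = - minus_lam_D D Q" for Q
    by (simp_all add: minus_lam_D_def additive.minus[OF additive_map_poly[OF D]])
  note am = additive_comp[OF tp additive_arrow_mult[OF D]]
  note r = additive_rmult_poly
  note f = additive_flip[OF D]
  \<comment> \<open>Here V is the image of \<open>\<lambda>\<^sub>1 + \<partial>\<close> with
    \<partial> acting on the whole value: -\<lambda> - \<partial> + \<partial> = -\<lambda>.\<close>
  show "to_poly D (arrow_mult D 2 1 P c) = rmult_poly c (to_poly D P)"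
  proof (rule vpolys_2_eqI[OF D am additive_comp[OF r tp], where i = 1 and j = 0 and U = "pCons 0"
      and V = "\<lambda>Q. - pCons 0 Q"])
  qed (use P in \<open>simp_all add: arrow_mult_vconst to_poly_vconst[OF D] rmult_poly_pCons
      arrow_mult_lam[OF D derivation]
      to_poly_lam[OF D, simplified] to_poly_map[OF D] additive.add[OF tp] additive.diff[OF tp]
          minus_lam_D_def
      additive.diff[OF r] additive.minus[OF r] additive.zero[OF r] insert_commute\<close>)
  \<comment> \<open>Now \<open>\<lambda>\<^sub>0 + \<partial>\<close> becomes \<lambda> +
    \<partial>, the negative of \<open>minus_lam_D D\<close>, while \<open>\<lambda>\<^sub>1\<close>
    itself becomes \<open>minus_lam_D D\<close>.\<close>
  show "to_poly D (arrow_mult D 2 0 P c) = flip D (rmult_poly c (flip D (to_poly D P)))"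
  proof (rule vpolys_2_eqI[OF D am additive_comp[OF f additive_comp[OF r additive_comp[OF f tp]]],
        where i = 0 and j = 1 and U = "minus_lam_D D" and V = "\<lambda>Q. - minus_lam_D D Q"])
  qed (use neg P in \<open>simp_all add: arrow_mult_vconst to_poly_vconst[OF D] rmult_poly_pCons
      arrow_mult_lam[OF D derivation]
      to_poly_lam[OF D, simplified] to_poly_map[OF D] additive.add[OF tp] additive.diff[OF tp]
      flip_const[OF D] flip_pCons_0[OF D] flip_minus_lam_D[OF D] flip_map[OF D] rmult_poly_minus_lam_D[OF D]
      additive.diff[OF r] additive.minus[OF r] additive.zero[OF r] additive.diff[OF f]
          additive.minus[OF f]\<close>)
qed

section \<open>Maps with two arguments as brackets\<close>

lemma all_args_2:
  fixes P :: "'a list \<Rightarrow> nat \<Rightarrow> 'b \<Rightarrow> 'c \<Rightarrow> bool"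
  shows "(\<forall>vs i a b. length vs = 2 \<and> i < 2 \<longrightarrow> P vs i a b) \<longleftrightarrow> (\<forall>x y a b. P [x, y] 0 a b \<and> P [x, y] 1 a b)"
proof safe
  fix vs :: "'a list" and i :: nat and a b
  assume H: "\<forall>x y a b. P [x, y] 0 a b \<and> P [x, y] 1 a b" and "length vs = 2" "i < 2"
  then obtain x y where "vs = [x, y]"
    by (auto simp: numeral_2_eq_2 length_Suc_conv)
  with H \<open>i < 2\<close> show "P vs i a b"
    by (auto simp: less_2_cases_iff)
qed auto

context diff_superalgebra
begin

lemma additive_D: "Modules.additive D"
proof -
  interpret D: Vector_Spaces.linear sc sc D
    by (rule D_linear)
  show ?thesis
    by (rule Modules.additive.intro) (rule D.add)
qed

lemma D_scale: "D (sc c a) = sc c (D a)"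
proof -
  interpret D: Vector_Spaces.linear sc sc D
    by (rule D_linear)
  show ?thesis
    by (rule D.scale)
qed

lemmas to_poly_add = additive.add[OF additive_to_poly[OF additive_D]]
  and to_poly_minus = additive.minus[OF additive_to_poly[OF additive_D]]

lemma to_poly_sg: "to_poly D (sg e P) = sg e (to_poly D P)"
  by (rule additive_commutes_sg) (rule additive_to_poly[OF additive_D])

lemma to_poly_scale: "to_poly D (Poly_Mapping.map (sc c) P) = map_poly (sc c) (to_poly D P)"
  unfolding to_poly_def
  by (intro vsubst_map additive_scale)
    (auto simp: additive_pCons_0 additive_minus_lam_D[OF additive_D] additive_const_poly
     additive_map_poly[OF additive_scale] map_poly_pCons_additive[OF additive_scale]
     minus_lam_D_def additive.diff[OF additive_map_poly[OF additive_scale]]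
     additive.minus[OF additive_map_poly[OF additive_scale]]
     poly_eq_iff map_poly_coeff[OF additive_scale] map_poly_coeff[OF additive_D] D_scale coeff_pCons
     additive.minus[OF additive_scale] additive.diff[OF additive_scale] split: nat.split)

lemma coeff_to_poly_in_G:
  assumes "\<And>m. Poly_Mapping.lookup P m \<in> G e"
  shows "coeff (to_poly D P) n \<in> G e"
proof -
  have "to_poly D P \<in> {Q. \<forall>n. coeff Q n \<in> G e}"
    unfolding to_poly_def using assms
    by (intro vsubst_closed)
      (auto simp: zero_in_G add_in_G minus_lam_D_def coeff_pCons map_poly_coeff[OF additive_D]
       intro!: diff_in_G uminus_in_G D_even split: nat.split)
  then show ?thesis
    by simp
qed

lemma lookup_of_poly_in_G:
  assumes "\<And>n. coeff Q n \<in> G e"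
  shows "Poly_Mapping.lookup (of_poly Q) m \<in> G e"
proof -
  have "of_poly Q \<in> {P. \<forall>m. Poly_Mapping.lookup P m \<in> G e}"
    unfolding of_poly_def using assms
    by (intro psubst_closed)
      (auto simp: zero_in_G add_in_G lookup_add vconst_def lam_def lookup_sum lookup_single when_def
       intro!: subspace_sum[OF subspace_G])
  then show ?thesis
    by simp
qed

text \<open>The inverse of \<open>at_lam\<close>: each class is given by its representative that is
  free of \<open>\<lambda>\<^sub>1\<close>.\<close>

definition of_bilinear :: "('v \<Rightarrow> 'v \<Rightarrow> 'v poly) \<Rightarrow> 'v list \<Rightarrow> 'v vpoly set" where
  "of_bilinear A = (\<lambda>vs\<in>{vs. length vs = 2}. qclass D 2 (of_poly (A (vs ! 0) (vs ! 1))))"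

lemma of_bilinear_ext: "of_bilinear A \<in> {vs. length vs = 2} \<rightarrow>\<^sub>E qspace D 2"
  by (auto simp: of_bilinear_def qspace_def of_poly_in_vpolys)

lemma at_lam_of_bilinear: "at_lam D (of_bilinear A) a b = A a b"
proof -
  have "qclass D 2 (qrep (of_bilinear A [a, b])) = qclass D 2 (of_poly (A a b))"
    by (simp add: of_bilinear_def qclass_qrep[OF additive_D])
  moreover have "qrep (of_bilinear A [a, b]) \<in> vpolys 2"
    by (simp add: of_bilinear_def qrep_in_vpolys[OF additive_D] of_poly_in_vpolys)
  ultimately show ?thesis
    by (simp add: at_lam_eq_to_poly qclass_eq_iff_to_poly[OF additive_D] of_poly_in_vpolys
        to_poly_of_poly[OF additive_D])
qed

section \<open>Conditions on an element with two arguments as identities for its bracket\<close>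

context
  fixes X :: "'v list \<Rightarrow> 'v vpoly set" and A :: "'v \<Rightarrow> 'v \<Rightarrow> 'v poly"
  assumes ext: "X \<in> {vs. length vs = 2} \<rightarrow>\<^sub>E qspace D 2"
    and A: "A = at_lam D X"
begin

lemma qrep_arg:
  shows "qrep (X [a, b]) \<in> vpolys 2" "to_poly D (qrep (X [a, b])) = A a b"
    "qclass D 2 (qrep (X [a, b])) = X [a, b]"
proof -
  have X: "X [a, b] \<in> qspace D 2"
    using ext by (auto simp: PiE_iff)
  show "to_poly D (qrep (X [a, b])) = A a b"
    by (simp add: A at_lam_eq_to_poly)
  show "qrep (X [a, b]) \<in> vpolys 2" "qclass D 2 (qrep (X [a, b])) = X [a, b]"
    using qspaceE[OF additive_D X] by auto
qed

text \<open>The translation principle: \<open>to_poly\<close> separates classes, so each defining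
  equation between classes becomes an equation in V[\<lambda>] without any choice of
  representatives.\<close>

lemma arg_eq_iff:
  assumes "P \<in> vpolys 2"
  shows "X [a, b] = qclass D 2 P \<longleftrightarrow> A a b = to_poly D P"
  using qclass_eq_iff_to_poly[OF additive_D qrep_arg(1)[of a b] assms] by (simp add: qrep_arg)

lemma of_bilinear_at_lam: "of_bilinear A = X"
proof
  fix vs
  show "of_bilinear A vs = X vs"
  proof (cases "length vs = 2")
    case True
    then obtain a b where "vs = [a, b]"
      by (auto simp: numeral_2_eq_2 length_Suc_conv)
    then show ?thesis
      using arg_eq_iff[OF of_poly_in_vpolys, of a b "A a b"]
      by (simp add: of_bilinear_def to_poly_of_poly[OF additive_D])
  next
    case False
    then show ?thesis
      using PiE_arb[OF ext, of vs] by (simp add: of_bilinear_def)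
  qed
qed

lemma arg_add_iff:
  "X [a, b] = qclass D 2 (qrep (X [a', b']) + qrep (X [a'', b''])) \<longleftrightarrow> A a b = A a' b' + A a'' b''"
  by (simp add: arg_eq_iff add_in_vpolys qrep_arg to_poly_add)

lemma arg_scale_iff:
  "X [a, b] = qclass D 2 (Poly_Mapping.map (sc c) (qrep (X [a', b']))) \<longleftrightarrow> A a b = map_poly (sc c) (A a' b')"
  by (simp add: arg_eq_iff map_in_vpolys qrep_arg to_poly_scale)

lemma multilinear_iff:
  "(\<forall>vs i a b. length vs = 2 \<and> i < 2 \<longrightarrow>
      X (vs[i := a + b]) = qclass D 2 (qrep (X (vs[i := a])) + qrep (X (vs[i := b])))) \<longleftrightarrow>
    (\<forall>a a' b. A (a + a') b = A a b + A a' b) \<and> (\<forall>a b b'. A a (b + b') = A a b + A a b')"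
  "(\<forall>vs i c a. length vs = 2 \<and> i < 2 \<longrightarrow>
      X (vs[i := sc c a]) = qclass D 2 (Poly_Mapping.map (sc c) (qrep (X (vs[i := a]))))) \<longleftrightarrow>
    (\<forall>c a b. A (sc c a) b = map_poly (sc c) (A a b)) \<and> (\<forall>c a b. A a (sc c b) = map_poly (sc c) (A a b))"
  unfolding all_args_2 One_nat_def list_update_code nth_Cons_0 arg_add_iff arg_scale_iff
  by iprover+

text \<open>The two positions give the two rules: \<open>-\<lambda>\<^sub>0\<close> is -\<lambda>,
  and \<open>-\<lambda>\<^sub>1\<close> is \<lambda> + \<partial>.\<close>

lemma sesquilinear_iff:
  "(\<forall>vs i. length vs = 2 \<and> i < 2 \<longrightarrow> X (vs[i := D (vs ! i)]) = qclass D 2 (- lam i (qrep (X vs)))) \<longleftrightarrow>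
    (\<forall>a b. A (D a) b = - pCons 0 (A a b)) \<and> (\<forall>a b. A a (D b) = pCons 0 (A a b) + map_poly D (A a b))"
  using all_args_2[of "\<lambda>vs i _ _. X (vs[i := D (vs ! i)]) = qclass D 2 (- lam i (qrep (X vs)))"]
  by (simp add: all_conj_distrib arg_eq_iff uminus_in_vpolys lam_in_vpolys qrep_arg to_poly_minus
      to_poly_lam[OF additive_D, simplified]
      minus_lam_D_def add.commute del: minus_pCons)

text \<open>The identity permutation gives a tautology, and the transposition acts by
  \<open>flip\<close>. The exponent contains e + 1 and f + 1 because the sign refers to the reversed
  parity.\<close>

lemma symmetric_iff:
  "(\<forall>fs vs \<sigma>. length vs = 2 \<and> homogeneous_args (reverse_parity G) fs vs \<and> \<sigma> permutes {..<2} \<longrightarrow>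
        X vs = qclass D 2 (sg (eps 2 fs \<sigma>)
          (vsubst (\<lambda>j. lam (\<sigma> j)) 2 vconst (qrep (X (map (\<lambda>j. vs ! \<sigma> j) [0..<2])))))) \<longleftrightarrow>
    (\<forall>e f a b. a \<in> G e \<and> b \<in> G f \<longrightarrow> A b a = sg ((e + 1) * (f + 1)) (flip D (A a b)))"
    (is "?L \<longleftrightarrow> ?R")
proof -
  let ?S = "\<lambda>fs vs \<sigma>. sg (eps 2 fs \<sigma>) (vsubst (\<lambda>j. lam (\<sigma> j)) 2 vconst
      (qrep (X (map (\<lambda>j. vs ! \<sigma> j) [0..<2]))))"
  have in_vpolys: "?S fs vs \<sigma> \<in> vpolys 2" if "\<sigma> permutes {..<2}" for fs vs \<sigma>
    using that permutes_in_image[OF that]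
    by (intro sg_in_vpolys vsubst_in_vpolys lam_in_vpolys vconst_in_vpolys) auto
  have upt: "[0..<2] = [0, 1::nat]"
    by (simp add: upt_rec)
  have id: "X [a, b] = qclass D 2 (?S fs [a, b] id)" for a b fs
    unfolding arg_eq_iff[OF in_vpolys[OF permutes_id]]
    by (simp add: to_poly_sg to_poly_permute(1)[OF additive_D, simplified] eps_id upt qrep_arg)
  have swap: "X [a, b] = qclass D 2 (?S [e, f] [a, b] (Transposition.transpose 0 1)) \<longleftrightarrow>
      A a b = sg (e * f) (flip D (A b a))" for a b e f
  proof -
    have "Transposition.transpose 0 1 permutes {..<2::nat}"
      by (intro permutes_swap_id) auto
    note * = arg_eq_iff[OF in_vpolys[OF this], of a b "[e, f]" "[a, b]"]
    show ?thesis
      unfolding * by (simp only: to_poly_sg to_poly_permute(2)[OF additive_D] eps_2_transpose)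
        (simp add: upt qrep_arg)
  qed
  show ?thesis
  proof (intro iffI allI impI; elim conjE)
    fix e f a b assume L: ?L and ab: "a \<in> G e" "b \<in> G f"
    then have "homogeneous_args (reverse_parity G) [f + 1, e + 1] [b, a]"
      by (simp add: homogeneous_args_2 reverse_parity_def add.commute)
    moreover have "Transposition.transpose 0 1 permutes {..<2::nat}"
      by (intro permutes_swap_id) auto
    ultimately have "A b a = sg ((f + 1) * (e + 1)) (flip D (A a b))"
      using L unfolding swap[symmetric] by simp
    then show "A b a = sg ((e + 1) * (f + 1)) (flip D (A a b))"
      by (simp only: mult.commute)
  next
    fix fs :: "bit list" and vs and \<sigma> :: "nat \<Rightarrow> nat"
    assume R: ?R and len: "length vs = 2" and hom: "homogeneous_args (reverse_parity G) fs vs"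
        and p: "\<sigma> permutes {..<2}"
    from len obtain a b where vs: "vs = [a, b]"
      by (auto simp: numeral_2_eq_2 length_Suc_conv)
    with hom obtain e f where fs: "fs = [e, f]" and ab: "a \<in> G (e + 1)" "b \<in> G (f + 1)"
      by (auto simp: homogeneous_args_2 reverse_parity_def)
    \<comment> \<open>Here e and f are reversed parities, so the original parities of a and b are e
      + 1 and f + 1; the double shift cancels.\<close>
    have "A a b = sg ((f + 1 + 1) * (e + 1 + 1)) (flip D (A b a))"
      using R ab by blast
    then have "A a b = sg (e * f) (flip D (A b a))"
      by (simp add: add.assoc mult.commute)
    then have "X [a, b] = qclass D 2 (?S [e, f] [a, b] (Transposition.transpose 0 1))"
      unfolding swap .
    with id p show "X vs = qclass D 2 (?S fs vs \<sigma>)"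
      unfolding permutes_lessThan_2 vs fs by blast
  qed
qed

text \<open>The shifts by 1 of the map, of its two arguments and of its value cancel modulo 2, so an
  odd map for the reversed parity preserves the original one. A class has a homogeneous
  representative exactly if its image in V[\<lambda>] is homogeneous.\<close>

lemma W_parity_iff:
  "W_parity (reverse_parity G) 2 1 X \<longleftrightarrow>
    (\<forall>e f a b n. a \<in> G e \<and> b \<in> G f \<longrightarrow> coeff (A a b) n \<in> G (e + f))"
proof -
  have mem: "P \<in> X [a, b] \<Longrightarrow> A a b = to_poly D P" for P a b
  proof -
    assume "P \<in> X [a, b]"
    then have *: "P \<in> qclass D 2 (qrep (X [a, b]))"
      by (simp add: qrep_arg)
    then have "P \<in> vpolys 2"
      using qrep_arg(1)[of a b] by (auto simp: qclass_def intro!: add_in_vpolys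
          total_op_in_vpolys[OF additive_D])
    moreover have "X [a, b] = qclass D 2 P"
      using *[unfolded mem_qclass_iff[OF additive_D]] by (simp add: qrep_arg)
    ultimately show "A a b = to_poly D P"
      by (simp add: arg_eq_iff)
  qed
  have of_poly_mem: "of_poly (A a b) \<in> X [a, b]" for a b
  proof -
    have "of_poly (A a b) \<in> qclass D 2 (of_poly (A a b))"
      by (simp add: mem_qclass_iff[OF additive_D])
    then show ?thesis
      using arg_eq_iff[OF of_poly_in_vpolys, of a b "A a b"] by (simp add: to_poly_of_poly[OF additive_D])
  qed
  \<comment> \<open>All representatives have the same image under \<open>to_poly\<close>, which
    preserves homogeneity; conversely \<open>of_poly\<close> of that image is a homogeneous
    representative.\<close>
  have *: "(\<exists>P\<in>X [a, b]. \<forall>m. Poly_Mapping.lookup P m \<in> G e) \<longleftrightarrow> (\<forall>n. coeff (A a b) n \<in> G e)" for a b e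
    using mem of_poly_mem coeff_to_poly_in_G lookup_of_poly_in_G by metis
  have "W_parity (reverse_parity G) 2 1 X \<longleftrightarrow>
    (\<forall>vs. length vs = 2 \<longrightarrow> (\<forall>fs. homogeneous_args (reverse_parity G) fs vs \<longrightarrow>
      (\<exists>P\<in>X vs. \<forall>m. Poly_Mapping.lookup P m \<in> reverse_parity G (1 + sum_list fs))))"
    unfolding W_parity_def by iprover
  also have "\<dots> \<longleftrightarrow> (\<forall>a b e f. a \<in> G (e + 1) \<and> b \<in> G (f + 1) \<longrightarrow> (\<forall>n. coeff (A a b) n \<in> G (e + f)))"
  proof -
    have "(1 + (e + f)) + 1 = e + f" for e f :: bit
      by (cases e; cases f; simp)
    then have "(\<exists>P\<in>X [a, b]. \<forall>m. Poly_Mapping.lookup P m \<in> reverse_parity G (1 + sum_list [e, f]))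
        \<longleftrightarrow> (\<forall>n. coeff (A a b) n \<in> G (e + f))" for a b e f
      by (simp add: reverse_parity_def *)
    moreover have "(\<forall>fs. homogeneous_args (reverse_parity G) fs [a, b] \<longrightarrow> Q fs) \<longleftrightarrow>
        (\<forall>e f. a \<in> G (e + 1) \<and> b \<in> G (f + 1) \<longrightarrow> Q [e, f])" for a b Q
      by (auto simp: homogeneous_args_2 reverse_parity_def)
    ultimately show ?thesis
      unfolding all_length_2 by (simp only:)
  qed
  also have "\<dots> \<longleftrightarrow> (\<forall>e f a b n. a \<in> G e \<and> b \<in> G f \<longrightarrow> coeff (A a b) n \<in> G (e + f))"
  proof safe
    fix e f a b n
    assume "\<forall>a b e f. a \<in> G (e + 1) \<and> b \<in> G (f + 1) \<longrightarrow> (\<forall>n. coeff (A a b) n \<in> G (e + f))" "a \<in> G e" "b \<in> G f"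
    moreover have "(e + 1) + 1 = e" "(f + 1) + 1 = f" "(e + 1) + (f + 1) = e + f"
      by (simp_all add: ac_simps)
    ultimately show "coeff (A a b) n \<in> G (e + f)"
      by metis
  next
    fix e f a b n
    assume "\<forall>e f a b n. a \<in> G e \<and> b \<in> G f \<longrightarrow> coeff (A a b) n \<in> G (e + f)" "a \<in> G (e + 1)" "b \<in> G (f + 1)"
    moreover have "(e + 1) + (f + 1) = e + f"
      by (simp_all add: ac_simps)
    ultimately show "coeff (A a b) n \<in> G (e + f)"
      by metis
  qed
  finally show ?thesis .
qed

lemma W_iff:
  "X \<in> W sc (reverse_parity G) D 2 \<longleftrightarrow>
    ((\<forall>a a' b. A (a + a') b = A a b + A a' b) \<and> (\<forall>a b b'. A a (b + b') = A a b + A a b')) \<and>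
    ((\<forall>c a b. A (sc c a) b = map_poly (sc c) (A a b)) \<and> (\<forall>c a b. A a (sc c b) = map_poly (sc c) (A a b))) \<and>
    ((\<forall>a b. A (D a) b = - pCons 0 (A a b)) \<and> (\<forall>a b. A a (D b) = pCons 0 (A a b) + map_poly D (A a b))) \<and>
    (\<forall>e f a b. a \<in> G e \<and> b \<in> G f \<longrightarrow> A b a = sg ((e + 1) * (f + 1)) (flip D (A a b)))"
  unfolding W_def mem_Collect_eq multilinear_iff sesquilinear_iff symmetric_iff
  using ext by blast

text \<open>At the last position the parity sum is empty and \<open>n - 1 - i\<close> is 0, which
  leaves the usual sign of the Leibniz rule. At the first position the \<open>flip\<close> in the
  rule is the one produced by the symmetry of A.\<close>

lemma W_as_iff:
  assumes W: "X \<in> W sc (reverse_parity G) D 2"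
  shows "X \<in> W_as sc G D 2 \<longleftrightarrow> (\<forall>e f g a b c. a \<in> G e \<and> b \<in> G f \<and> c \<in> G g \<longrightarrow>
      A a (b * c) = rmult_poly c (A a b) + sg (f * g) (rmult_poly b (A a c)))" (is "_ \<longleftrightarrow> ?R")
proof -
  have sym: "A b a = sg ((e + 1) * (f + 1)) (flip D (A a b))" if "a \<in> G e" "b \<in> G f" for e f a b
    using W that unfolding W_iff by blast
  let ?E = "\<lambda>i fs vs pb pc b c. X (vs[i := b * c]) = qclass D 2
          (sg (pc * ((\<Sum>j\<in>{i<..<2}. fs ! j) + of_nat (2 - 1 - i)))
              (arrow_mult D 2 i (qrep (X (vs[i := b]))) c)
           + sg (pb * (pc + ((\<Sum>j\<in>{i<..<2}. fs ! j) + of_nat (2 - 1 - i))))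
               (arrow_mult D 2 i (qrep (X (vs[i := c]))) b))"
  have first: "?E 0 [e, f] [v, a] pb pc b c \<longleftrightarrow>
      A (b * c) a = sg (pc * (f + 1)) (flip D (rmult_poly c (flip D (A b a))))
        + sg (pb * (pc + (f + 1))) (flip D (rmult_poly b (flip D (A c a))))" for e f v a pb pc b c
  proof -
    have "{0<..<2} = {1::nat}"
      by auto
    then show ?thesis
      by (simp add: arg_eq_iff add_in_vpolys sg_in_vpolys arrow_mult_in_vpolys to_poly_add to_poly_sg
        to_poly_arrow_mult[OF additive_D D_derivation] qrep_arg)
  qed
  have second: "?E 1 [e, f] [a, v] pb pc b c \<longleftrightarrow>
      A a (b * c) = rmult_poly c (A a b) + sg (pb * pc) (rmult_poly b (A a c))" for e f v a pb pc b c
  proof -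
    have "{1<..<2} = ({}::nat set)"
      by auto
    then show ?thesis
      by (simp add: arg_eq_iff add_in_vpolys sg_in_vpolys arrow_mult_in_vpolys to_poly_add to_poly_sg
        to_poly_arrow_mult(1)[OF additive_D D_derivation, simplified] qrep_arg)
  qed
  have "X \<in> W_as sc G D 2 \<longleftrightarrow> (\<forall>i fs vs pb pc b c. i < 2 \<and> length vs = 2 \<and> homogeneous_args G fs vs \<and>
         b \<in> G pb \<and> c \<in> G pc \<longrightarrow> ?E i fs vs pb pc b c)"
    using W by (simp add: W_as_def Let_def)
  also have "\<dots> \<longleftrightarrow> ?R"
  proof (intro iffI allI impI; elim conjE)
    fix e f g a b c
    assume "\<forall>i fs vs pb pc b c. i < 2 \<and> length vs = 2 \<and> homogeneous_args G fs vs \<and>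
         b \<in> G pb \<and> c \<in> G pc \<longrightarrow> ?E i fs vs pb pc b c" and abc: "a \<in> G e" "b \<in> G f" "c \<in> G g"
    \<comment> \<open>The second argument is overwritten by the update, so 0 serves as a
      placeholder.\<close>
    moreover have "homogeneous_args G [e, 0] [a, 0]"
      using abc zero_in_G by (simp add: homogeneous_args_2)
    ultimately have "?E 1 [e, 0] [a, 0] f g b c"
      by (metis (no_types, lifting) length_Cons list.size(3) numeral_2_eq_2 one_less_numeral_iff
          semiring_norm(76))
    then show "A a (b * c) = rmult_poly c (A a b) + sg (f * g) (rmult_poly b (A a c))"
      unfolding second .
  next
    fix i :: nat and fs vs pb pc b c
    assume R: ?R and i: "i < 2" "length vs = 2" "homogeneous_args G fs vs" and bc: "b \<in> G pb" "c \<in> G pc"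
    then obtain x y e f where vs: "vs = [x, y]" "fs = [e, f]" and xy: "x \<in> G e" "y \<in> G f"
      by (auto simp: numeral_2_eq_2 length_Suc_conv homogeneous_args_2)
    consider "i = 0" | "i = 1"
      using i by linarith
    then show "?E i fs vs pb pc b c"
    proof cases
      case 1
      have "A (b * c) y = sg ((f + 1) * (pb + pc + 1)) (flip D (A y (b * c)))"
        by (rule sym[OF xy(2) mult_parity[OF bc]])
      also have "A y (b * c) = rmult_poly c (A y b) + sg (pb * pc) (rmult_poly b (A y c))"
        using R xy bc by blast
      also have "A y b = sg ((pb + 1) * (f + 1)) (flip D (A b y))"
        by (rule sym[OF bc(1) xy(2)])
      also have "A y c = sg ((pc + 1) * (f + 1)) (flip D (A c y))"
        by (rule sym[OF bc(2) xy(2)])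
      finally have "A (b * c) y =
          sg ((f + 1) * (pb + pc + 1)) (sg ((pb + 1) * (f + 1)) (flip D (rmult_poly c (flip D (A b y)))))
          + sg ((f + 1) * (pb + pc + 1)) (sg (pb * pc)
              (sg ((pc + 1) * (f + 1)) (flip D (rmult_poly b (flip D (A c y))))))"
        by (simp add: additive_commutes_sg[OF additive_rmult_poly]
            additive_commutes_sg[OF additive_flip[OF additive_D]]
            additive.add[OF additive_flip[OF additive_D]] additive.add[OF additive_sg])
      then have "A (b * c) y = sg (pc * (f + 1)) (flip D (rmult_poly c (flip D (A b y))))
        + sg (pb * (pc + (f + 1))) (flip D (rmult_poly b (flip D (A c y))))"
        \<comment> \<open>In the exponents, \<open>(f + 1) * (pb + pc + 1)\<close> and
          \<open>(pb + 1) * (f + 1)\<close> add up to \<open>pc * (f + 1)\<close>, and similarly for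
          the second summand.\<close>
        by (cases f; cases pb; cases pc; simp)
      then show ?thesis
        unfolding 1 vs first .
    next
      case 2
      show ?thesis
        unfolding 2 vs second using R xy bc by blast
    qed
  qed
  finally show ?thesis .
qed

end

end

section \<open>The condition on the square\<close>

lemma sum_lessThan_2: "sum f {..<2::nat} = f 0 + f 1"
  by (simp add: numeral_2_eq_2)

lemma sum_lessThan_3: "sum f {..<3::nat} = f 0 + f 1 + f 2"
  by (simp add: numeral_3_eq_3 numeral_2_eq_2)

text \<open>The three unshuffle terms of X box X once every inner value has been moved to the
  position it has in the Jacobi identity. Here e and f are the original parities of a and b; the
  parity of c cancels from all signs.\<close>

definition jacobi_sum :: "('v::ab_group_add \<Rightarrow> 'v \<Rightarrow> 'v poly) \<Rightarrow> bit \<Rightarrow> bit \<Rightarrow> 'v \<Rightarrow> 'v \<Rightarrow> 'v \<Rightarrow> 'v vpoly" where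
  "jacobi_sum A e f a b c =
     psubst (lam 0) (\<lambda>y. psubst (\<lambda>Q. lam 0 Q + lam 1 Q) vconst (A y c)) (A a b)
     + sg ((f + 1) * e) (psubst (lam 0) (\<lambda>y. psubst (lam 1) vconst (A b y)) (A a c))
     + sg (e + 1) (psubst (lam 1) (\<lambda>y. psubst (lam 0) vconst (A a y)) (A b c))"

context diff_superalgebra
begin

lemma double_eq_0:
  assumes "P + P = (0 :: 'v vpoly)" shows "P = 0"
proof (rule poly_mapping_eqI)
  fix m
  have "sc (1 + 1) (Poly_Mapping.lookup P m) = Poly_Mapping.lookup (P + P) m"
    by (simp only: scale_left_distrib scale_one lookup_add)
  then have "(1 + 1 :: 'k) = 0 \<or> Poly_Mapping.lookup P m = 0"
    by (simp only: assms lookup_zero scale_eq_0_iff)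
  moreover have "(1 + 1 :: 'k) \<noteq> 0"
    by simp
  ultimately show "Poly_Mapping.lookup P m = Poly_Mapping.lookup 0 m"
    by simp
qed

text \<open>The operators by which \<open>elim_last D 2\<close> replaces \<open>\<lambda>\<^sub>0, \<lambda>\<^sub>1, \<lambda>\<^sub>2\<close>.\<close>

definition red :: "nat \<Rightarrow> 'v vpoly \<Rightarrow> 'v vpoly" where
  "red j = (if j < 2 then lam j else (\<lambda>Q. - total_op D 2 Q))"

lemma additive_red: "Modules.additive (red j)"
  by (simp add: red_def additive_lam additive_uminus[OF additive_total_op[OF additive_D]])

lemma red_commute: "red i (red j Q) = red j (red i Q)"
  by (auto simp: red_def lam_commute additive.minus[OF additive_lam]
      total_op_lam[OF additive_D])

lemma elim_last_lam_red: "j < 3 \<Longrightarrow> elim_last D 2 (lam j P) = red j (elim_last D 2 P)"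
  using elim_last_lam[OF additive_D, of j 2 P] by (simp add: red_def)

text \<open>A permutation does not change the sum of the three operators, and the third is minus the
  first two minus \<partial>. This supplies the compatibility needed to merge the nested
  substitutions.\<close>

lemma sum_red:
  assumes "\<sigma> permutes {..<3}"
  shows "red (\<sigma> 0) Q + red (\<sigma> 1) Q + red (\<sigma> 2) Q = - Poly_Mapping.map D Q"
proof -
  have "(\<Sum>j<3. red (\<sigma> j) Q) = (\<Sum>j<3. red j Q)"
    using sum.permute[OF assms, of "\<lambda>j. red j Q"] by (simp add: comp_def)
  then show ?thesis
    unfolding sum_lessThan_3 by (simp add: red_def total_op_def numeral_2_eq_2)
qed

lemma psubst_map_D:
  assumes "Modules.additive T" "\<And>Q. Poly_Mapping.map D (T Q) = T (Poly_Mapping.map D Q)"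
  shows "psubst T vconst (map_poly D Q) = Poly_Mapping.map D (psubst T vconst Q)"
  by (rule psubst_map_poly)
    (use assms in \<open>simp_all add: additive_vconst additive_D additive_map map_vconst\<close>)

lemma map_red: "Poly_Mapping.map D (red j Q) = red j (Poly_Mapping.map D Q)"
  by (simp add: red_def map_lam_commute[OF additive_D] map_total_op[OF additive_D]
      additive.minus[OF additive_map[OF additive_D]])

context
  fixes X :: "'v list \<Rightarrow> 'v vpoly set" and A :: "'v \<Rightarrow> 'v \<Rightarrow> 'v poly"
  assumes ext: "X \<in> {vs. length vs = 2} \<rightarrow>\<^sub>E qspace D 2"
    and A: "A = at_lam D X"
    and A_add: "\<And>a a' b. A (a + a') b = A a b + A a' b" "\<And>a b b'. A a (b + b') = A a b + A a b'"
    and A_D: "\<And>a b. A (D a) b = - pCons 0 (A a b)"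
begin

lemma A_0: "A 0 b = 0" "A a 0 = 0"
  using A_add(1)[of 0 0 b] A_add(2)[of a 0 0] by simp_all

lemma additive_psubst_A:
  assumes "Modules.additive T"
  shows "Modules.additive (\<lambda>y. psubst T vconst (A y b))"
  by (rule additive_comp[OF additive_psubst[OF assms additive_vconst]])
    (simp add: Modules.additive_def A_add)

text \<open>For the outer map, the operators \<open>red (\<sigma> 0) + red (\<sigma> 1)\<close> and
  \<open>red (\<sigma> 2)\<close> add up to -\<partial>, so its value becomes the bracket A at the
  first of them. For the inner map, \<partial> is shifted by sesquilinearity to the variables, which
  makes its two operators compatible as well.\<close>

lemma elim_last_box_term:
  assumes \<sigma>: "\<sigma> permutes {..<3}"
  shows "elim_last D 2 (box_term 2 2 X X \<sigma> vs) =
    psubst (red (\<sigma> 0)) (\<lambda>y. psubst (\<lambda>Q. red (\<sigma> 0) Q + red (\<sigma> 1) Q) vconst (A y (vs ! \<sigma> 2)))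
      (A (vs ! \<sigma> 0) (vs ! \<sigma> 1))"
proof -
  have \<sigma>_less: "\<sigma> j < 3" if "j < 3" for j
    using permutes_in_image[OF \<sigma>, of j] that by simp
  let ?U = "\<lambda>Q. red (\<sigma> 0) Q + red (\<sigma> 1) Q"
  let ?x = "vs ! \<sigma> 0" and ?y = "vs ! \<sigma> 1" and ?z = "vs ! \<sigma> 2"
  let ?\<Phi> = "\<lambda>y. psubst ?U vconst (A y ?z)"
  note el = additive_elim_last[OF additive_D]
  have U: "Modules.additive ?U"
    by (intro additive_plus additive_red)
  note \<Phi> = additive_psubst_A[OF U, of ?z]
  have sum: "- ?U Q - red (\<sigma> 2) Q = Poly_Mapping.map D Q" for Q
  proof -
    have "- ?U Q - red (\<sigma> 2) Q = - (?U Q + red (\<sigma> 2) Q)"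
      by simp
    then show ?thesis
      by (simp only: sum_red[OF \<sigma>] minus_minus)
  qed
  have inner: "elim_last D 2 (vsubst (\<lambda>j. if j = 0 then (\<lambda>Q. \<Sum>l<2. lam (\<sigma> l) Q) else lam (\<sigma> (2 + j - 1)))
      2 vconst
      (qrep (X [y, ?z]))) = ?\<Phi> y" for y
  proof -
    have "elim_last D 2 (vsubst (\<lambda>j. if j = 0 then (\<lambda>Q. \<Sum>l<2. lam (\<sigma> l) Q) else lam (\<sigma> (2 + j - 1)))
        2 vconst
        (qrep (X [y, ?z])))
      = vsubst (\<lambda>j. if j = 0 then ?U else red (\<sigma> 2)) 2 (\<lambda>v. elim_last D 2 (vconst v)) (qrep (X [y, ?z]))"
      by (rule vsubst_intertwine[OF el])
        (auto simp: less_2_cases_iff sum_lessThan_2 additive.add[OF el] elim_last_lam_red \<sigma>_less simp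
            del: One_nat_def simp flip: numeral_2_eq_2)
    also have "\<dots> = vsubst (\<lambda>j. if j = 0 then ?U else red (\<sigma> 2)) 2 vconst (qrep (X [y, ?z]))"
      by (simp add: elim_last_vconst[OF additive_D])
    also have "\<dots> = psubst ?U vconst (to_poly D (qrep (X [y, ?z])))"
    proof (rule psubst_to_poly[OF additive_D U additive_vconst additive_red, symmetric])
      show "psubst ?U vconst (map_poly D x) = - ?U (psubst ?U vconst x)
          - red (\<sigma> 2) (psubst ?U vconst x)" for x
        unfolding sum by (rule psubst_map_D[OF U])
            (simp add: additive.add[OF additive_map[OF additive_D]] map_red)
    qed
    finally show ?thesis
      by (simp add: qrep_arg(2)[OF ext A])
  qed
  have upt: "map (\<lambda>l. vs ! \<sigma> l) [2..<2 + 2 - 1] = [?z]" "map (\<lambda>l. vs ! \<sigma> l) [0..<2] = [?x, ?y]"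
    by (simp_all add: upt_rec)
  have "elim_last D 2 (box_term 2 2 X X \<sigma> vs) = vsubst (\<lambda>j. red (\<sigma> j)) 2 ?\<Phi> (qrep (X [?x, ?y]))"
  proof -
    have "elim_last D 2 (vsubst (\<lambda>j. lam (\<sigma> j)) 2 \<psi> P)
        = vsubst (\<lambda>j. red (\<sigma> j)) 2 (\<lambda>v. elim_last D 2 (\<psi> v)) P" for \<psi> and P :: "'v vpoly"
      by (rule vsubst_intertwine[OF el]) (simp add: elim_last_lam_red \<sigma>_less)
    then show ?thesis
      unfolding box_term_def upt by (simp only: inner)
  qed
  also have "\<dots> = vsubst (\<lambda>j. if j = 0 then red (\<sigma> 0) else red (\<sigma> 1)) 2 ?\<Phi> (qrep (X [?x, ?y]))"
    by (rule vsubst_cong) (auto simp: less_2_cases_iff)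
  also have "\<dots> = psubst (red (\<sigma> 0)) ?\<Phi> (to_poly D (qrep (X [?x, ?y])))"
  proof (rule psubst_to_poly[of D "red (\<sigma> 0)" ?\<Phi> "red (\<sigma> 1)", OF additive_D additive_red \<Phi> additive_red,
      symmetric])
    fix x
    \<comment> \<open>The derivation hits y, the first argument of the outer bracket, and therefore
      acts as minus the variable \<open>?U\<close> of that bracket.\<close>
    have "psubst (red (\<sigma> 0)) ?\<Phi> (map_poly D x) = - ?U (psubst (red (\<sigma> 0)) ?\<Phi> x)"
    proof (rule psubst_map_poly[of "red (\<sigma> 0)" ?\<Phi> D "\<lambda>Q. - ?U Q", OF additive_red \<Phi> additive_D
        additive_uminus[OF U]])
      show "?\<Phi> (D v) = - ?U (?\<Phi> v)" for v
        by (simp only: A_D additive.minus[OF additive_psubst[OF U additive_vconst]]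
            psubst_pCons_0[OF U additive_vconst])
      show "- ?U (red (\<sigma> 0) x) = red (\<sigma> 0) (- ?U x)" for x
        by (simp only: additive.add[OF additive_red] additive.minus[OF additive_red]
            red_commute[of "\<sigma> 1" "\<sigma> 0"])
    qed
    then show "psubst (red (\<sigma> 0)) ?\<Phi> (map_poly D x) = - red (\<sigma> 0) (psubst (red (\<sigma> 0)) ?\<Phi> x)
        - red (\<sigma> 1) (psubst (red (\<sigma> 0)) ?\<Phi> x)"
      by simp
  qed
  finally show ?thesis
    by (simp add: qrep_arg(2)[OF ext A])
qed

context
  assumes A_sym: "\<And>e f a b. a \<in> G e \<Longrightarrow> b \<in> G f \<Longrightarrow> A b a = sg ((e + 1) * (f + 1)) (flip D (A a b))"
    and A_parity: "\<And>e f a b n. a \<in> G e \<Longrightarrow> b \<in> G f \<Longrightarrow> coeff (A a b) n \<in> G (e + f)"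
begin

text \<open>Since \<open>\<lambda>\<^sub>i\<close> minus the total operator is
  \<open>-\<lambda>\<^sub>j - \<partial>\<close>, exchanging the arguments of the outer bracket
  turns this operator into \<open>\<lambda>\<^sub>j\<close>. The sign of the exchange depends on the
  parity of y, hence the assumption that all coefficients of P have the same parity p.\<close>

lemma psubst_swap_arg:
  assumes ij: "{i, j} = {0, 1}" and P: "\<And>n. coeff P n \<in> G p" and b: "b \<in> G f"
  shows "psubst (lam i) (\<lambda>y. psubst (\<lambda>Q. lam i Q - total_op D 2 Q) vconst (A y b)) P =
    sg ((p + 1) * (f + 1)) (psubst (lam i) (\<lambda>y. psubst (lam j) vconst (A b y)) P)"
proof -
  let ?U = "\<lambda>Q. lam i Q - total_op D 2 Q" and ?s = "sg ((p + 1) * (f + 1))"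
  have U: "Modules.additive ?U"
    by (intro additive_minus additive_lam additive_total_op additive_D)
  have sum: "- ?U Q - lam j Q = Poly_Mapping.map D Q" for Q
  proof -
    have "lam i Q + lam j Q = lam 0 Q + lam 1 Q"
      using ij by (auto simp: doubleton_eq_iff add.commute)
    moreover have "total_op D 2 Q = lam 0 Q + lam 1 Q + Poly_Mapping.map D Q"
      by (simp add: total_op_def numeral_2_eq_2)
    ultimately show ?thesis
      by (simp add: algebra_simps)
  qed
  have "psubst ?U vconst (flip D Q) = psubst (lam j) vconst Q" for Q
  proof (rule psubst_flip[OF additive_D U additive_vconst additive_lam])
    show "psubst ?U vconst (map_poly D x) = - ?U (psubst ?U vconst x) - lam j (psubst ?U vconst x)" for x
      unfolding sum
      by (rule psubst_map_D[OF U])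
        (simp add: map_lam_commute[OF additive_D] map_total_op[OF additive_D]
            additive.diff[OF additive_map[OF additive_D]])
  qed
  then have "psubst ?U vconst (A y b) = ?s (psubst (lam j) vconst (A b y))" if "y \<in> G p" for y
    using A_sym[OF b that]
    by (simp add: additive_commutes_sg[OF additive_psubst[OF U additive_vconst]] mult.commute)
  then have "psubst (lam i) (\<lambda>y. psubst ?U vconst (A y b)) P
      = psubst (lam i) (\<lambda>y. ?s (psubst (lam j) vconst (A b y))) P"
    using P by (intro psubst_cong) auto
  also have "\<dots> = ?s (psubst (lam i) (\<lambda>y. psubst (lam j) vconst (A b y)) P)"
    by (rule psubst_intertwine[symmetric]) (simp_all add: additive_sg additive_commutes_sg[OF additive_lam])
  finally show ?thesis .
qed

definition box_summand :: "bit list \<Rightarrow> 'v list \<Rightarrow> 'v vpoly" where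
  "box_summand fs us = (\<Sum>\<sigma>\<in>unshuffles 2 1. sg (eps 3 fs \<sigma>) (elim_last D 2 (box_term 2 2 X X \<sigma> us)))"

lemma box_summand_eq:
  "box_summand [e, f, g] [a, b, c] =
    psubst (lam 0) (\<lambda>y. psubst (\<lambda>Q. lam 0 Q + lam 1 Q) vconst (A y c)) (A a b)
    + sg (f * g) (psubst (lam 0) (\<lambda>y. psubst (\<lambda>Q. lam 0 Q - total_op D 2 Q) vconst (A y b)) (A a c))
    + sg (e * (f + g)) (psubst (lam 1) (\<lambda>y. psubst (\<lambda>Q. lam 1 Q - total_op D 2 Q) vconst (A y a)) (A b c))"
proof -
  let ?\<sigma> = "Transposition.transpose 1 (2::nat)" and ?\<tau>
      = "Transposition.transpose 0 2 \<circ> Transposition.transpose 0 (1::nat)"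
  have ne: "id \<noteq> ?\<sigma>" "id \<noteq> ?\<tau>" "?\<sigma> \<noteq> ?\<tau>"
    by (auto simp: fun_eq_iff Transposition.transpose_def)
  have p: "id permutes {..<3}" "?\<sigma> permutes {..<3}" "?\<tau> permutes {..<3}"
    by (auto intro!: permutes_id permutes_compose permutes_swap_id)
  have "box_summand [e, f, g] [a, b, c] =
    sg (eps 3 [e, f, g] id) (elim_last D 2 (box_term 2 2 X X id [a, b, c])) +
    sg (eps 3 [e, f, g] ?\<sigma>) (elim_last D 2 (box_term 2 2 X X ?\<sigma> [a, b, c])) +
    sg (eps 3 [e, f, g] ?\<tau>) (elim_last D 2 (box_term 2 2 X X ?\<tau> [a, b, c]))"
    unfolding box_summand_def unshuffles_2_1 using ne by (simp add: add.assoc)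
  moreover have "red 0 = lam 0" "red 1 = lam 1" "red 2 = (\<lambda>Q. - total_op D 2 Q)"
    by (simp_all add: red_def)
  ultimately show ?thesis
    unfolding elim_last_box_term[OF p(1)] elim_last_box_term[OF p(2)] elim_last_box_term[OF p(3)] eps_3
        eps_id
    by (simp add: Transposition.transpose_def del: One_nat_def)
qed

lemma box_summand_homogeneous:
  assumes "a \<in> G e" "b \<in> G f" "c \<in> G g"
  shows "box_summand [e + 1, f + 1, g + 1] [a, b, c] = jacobi_sum A e f a b c"
proof -
  \<comment> \<open>Signs of the unshuffles combined with those of the exchanges; the inner values
    \<open>A a c\<close> and \<open>A b c\<close> have parities e + g and f + g, and g drops
    out.\<close>
  have s: "sg ((f + 1) * (g + 1)) (sg ((e + g + 1) * (f + 1)) x) = sg ((f + 1) * e) x"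
    "sg ((e + 1) * (f + 1 + (g + 1))) (sg ((f + g + 1) * (e + 1)) x) = sg (e + 1) x" for x :: "'v vpoly"
    by (cases e; cases f; cases g; simp)+
  have "{0, 1} = {0, 1::nat}" "{1, 0} = {0, 1::nat}"
    by auto
  then show ?thesis
    unfolding box_summand_eq jacobi_sum_def
    by (simp only: s psubst_swap_arg[OF \<open>{0, 1} = {0, 1}\<close> A_parity[OF assms(1,3)] assms(2)]
        psubst_swap_arg[OF \<open>{1, 0} = {0, 1}\<close> A_parity[OF assms(2,3)] assms(1)])
qed

text \<open>For homogeneous arguments every wrong choice of parities yields a zero component, so
  this leaves a single summand in the decomposition.\<close>

lemma box_summand_0:
  assumes "a = 0 \<or> b = 0 \<or> c = 0"
  shows "box_summand [e, f, g] [a, b, c] = 0"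
proof -
  have "psubst T (\<lambda>y. 0) P = (0 :: 'v vpoly)" if "Modules.additive T" for T and P :: "'v poly"
    by (simp add: psubst_def additive.zero[OF additive_funpow[OF that]])
  then show ?thesis
    using assms unfolding box_summand_eq
    by (auto simp: A_0 psubst_def additive.zero[OF additive_vconst] additive.zero[OF additive_lam]
      additive.zero[OF additive_funpow[OF additive_lam]])
qed

text \<open>The bracket vanishes iff the normal form of X box X does at every triple. Splitting the
  arguments into homogeneous components reduces this to homogeneous triples, where the normal form
  is \<open>jacobi_sum\<close>.\<close>

lemma W_bracket_iff:
  "W_bracket (reverse_parity G) D 2 1 2 1 X X = W_zero D 3 \<longleftrightarrow>
    (\<forall>e f g a b c. a \<in> G e \<and> b \<in> G f \<and> c \<in> G g \<longrightarrow> jacobi_sum A e f a b c = 0)"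
proof -
  interpret rev: superspace sc "reverse_parity G"
    by (rule superspace_reverse_parity)
  let ?H = "reverse_parity G"
  let ?us = "\<lambda>fs vs. map2 (hcomp ?H) fs vs"
  define B where "B = (\<lambda>vs. \<Sum>fs | length fs = 3. \<Sum>\<sigma>\<in>unshuffles 2 1.
        sg (eps 3 fs \<sigma>) (box_term 2 2 X X \<sigma> (?us fs vs)))"
  have B_in: "B vs \<in> vpolys 3" for vs
  proof -
    have "box_term 2 2 X X \<sigma> us \<in> vpolys 3" if "\<sigma> \<in> unshuffles 2 1" for \<sigma> us
    proof -
      have "\<sigma> permutes {..<3}"
        using that by (simp add: unshuffles_def)
      then have "\<sigma> j < 3" if "j < 3" for j
        using permutes_in_image that by fastforce
      then show ?thesis
        unfolding box_term_def
        by (intro vsubst_in_vpolys) (auto intro!: lam_in_vpolys sum_in_vpolys vconst_in_vpolys)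
    qed
    then show ?thesis
      unfolding B_def by (intro sum_in_vpolys sg_in_vpolys)
  qed
  have el_B: "elim_last D 2 (B vs) = (\<Sum>fs | length fs = 3. box_summand fs (?us fs vs))" for vs
    unfolding B_def box_summand_def
    by (simp add: additive.sum[OF additive_elim_last[OF additive_D]]
        additive_commutes_sg[OF additive_elim_last[OF additive_D]])
  have bracket: "W_bracket ?H D 2 1 2 1 X X vs = W_zero D 3 vs \<longleftrightarrow> elim_last D 2 (B vs) = 0"
      if "length vs = 3" for vs
  proof -
    let ?P = "qrep (qclass D 3 (B vs))"
    have "W_box ?H D 2 2 X X vs = qclass D 3 (B vs)"
      using that by (simp add: W_box_def B_def)
    \<comment> \<open>The exponent is 1 * 1, so the difference of the two equal box terms turns into
      a sum.\<close>
    then have "W_bracket ?H D 2 1 2 1 X X vs = qclass D 3 (?P + ?P)"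
      using that by (simp add: W_bracket_def)
    moreover have "elim_last D 2 ?P = elim_last D 2 (B vs)" and P: "?P \<in> vpolys 3"
      using qclass_eq_iff_elim_last[OF additive_D, of ?P 2 "B vs"] B_in[of vs]
          qrep_in_vpolys[OF additive_D B_in]
        qclass_qrep[OF additive_D]
      by simp_all
    moreover have "qclass D 3 (?P + ?P) = qclass D 3 0 \<longleftrightarrow> elim_last D 2 ?P + elim_last D 2 ?P = 0"
      using qclass_eq_iff_elim_last[OF additive_D, of "?P + ?P" 2 0] P
      by (simp add: add_in_vpolys zero_in_vpolys additive.add[OF additive_elim_last[OF additive_D]]
          additive.zero[OF additive_elim_last[OF additive_D]])
    moreover have "W_zero D 3 vs = qclass D 3 0"
      using that by (simp add: W_zero_def)
    moreover have "Q + Q = 0 \<longleftrightarrow> Q = 0" for Q :: "'v vpoly"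
      by (rule iffI, erule double_eq_0) simp
    ultimately show ?thesis
      by (simp only:)
  qed
  have "W_bracket ?H D 2 1 2 1 X X = W_zero D 3 \<longleftrightarrow>
      (\<forall>vs. length vs = 3 \<longrightarrow> W_bracket ?H D 2 1 2 1 X X vs = W_zero D 3 vs)"
  proof -
    have "W_bracket ?H D 2 1 2 1 X X vs = W_zero D 3 vs" if "length vs \<noteq> 3" for vs
      using that by (simp add: W_bracket_def W_zero_def)
    then show ?thesis
      unfolding fun_eq_iff by blast
  qed
  also have "\<dots> \<longleftrightarrow> (\<forall>vs. length vs = 3 \<longrightarrow> (\<Sum>fs | length fs = 3. box_summand fs (?us fs vs)) = 0)"
    by (simp only: bracket el_B cong: imp_cong)
  also have "\<dots> \<longleftrightarrow> (\<forall>e f g a b c. a \<in> G e \<and> b \<in> G f \<and> c \<in> G g \<longrightarrow> jacobi_sum A e f a b c = 0)"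
  proof (intro iffI allI impI; (elim conjE)?)
    fix e f g a b c
    assume L: "\<forall>vs. length vs = 3 \<longrightarrow> (\<Sum>fs | length fs = 3. box_summand fs (?us fs vs)) = 0"
      and abc: "a \<in> G e" "b \<in> G f" "c \<in> G g"
    then have H: "a \<in> ?H (e + 1)" "b \<in> ?H (f + 1)" "c \<in> ?H (g + 1)"
      by (simp_all add: reverse_parity_def add.assoc)
    let ?fs = "[e + 1, f + 1, g + 1]"
    \<comment> \<open>A list different from the reversed parities of a, b, c picks a zero component
      of at least one of them.\<close>
    have other: "box_summand fs (?us fs [a, b, c]) = 0" if len: "length fs = 3" and ne: "fs \<noteq> ?fs" for fs
    proof -
      obtain e' f' g' where "fs = [e', f', g']"
        using len by (auto simp: numeral_3_eq_3 length_Suc_conv)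
      with ne show ?thesis
        using H by (auto simp: rev.hcomp_homogeneous intro!: box_summand_0)
    qed
    have "finite {fs :: bit list. length fs = 3}"
    proof -
      have "finite (UNIV :: bit set)"
        by (simp add: UNIV_bit)
      from finite_lists_length_eq[OF this, of 3] show ?thesis
        by simp
    qed
    then have "(\<Sum>fs | length fs = 3. box_summand fs (?us fs [a, b, c]))
        = (\<Sum>fs\<in>{?fs}. box_summand fs (?us fs [a, b, c]))"
      by (intro sum.mono_neutral_right) (use other in auto)
    also have "\<dots> = jacobi_sum A e f a b c"
      using H by (simp add: rev.hcomp_homogeneous box_summand_homogeneous[OF abc])
    finally show "jacobi_sum A e f a b c = 0"
      using L by simp
  next
    fix vs :: "'v list"
    assume R: "\<forall>e f g a b c. a \<in> G e \<and> b \<in> G f \<and> c \<in> G g \<longrightarrow> jacobi_sum A e f a b c = 0" and "length vs = 3"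
    then obtain a b c where vs: "vs = [a, b, c]"
      by (auto simp: numeral_3_eq_3 length_Suc_conv)
    have "box_summand fs (?us fs vs) = 0" if len: "length fs = 3" for fs
    proof -
      obtain e f g where fs: "fs = [e, f, g]"
        using len by (auto simp: numeral_3_eq_3 length_Suc_conv)
      have in_G: "hcomp ?H h x \<in> G (h + 1)" for h x
        using rev.hcomp_in[of h x] by (simp add: reverse_parity_def)
      have "(h + 1) + 1 = h" for h :: bit
        by (simp add: add.assoc)
      moreover have "jacobi_sum A (e + 1) (f + 1) (hcomp ?H e a) (hcomp ?H f b) (hcomp ?H g c) = 0"
        using R in_G by blast
      ultimately show ?thesis
        using box_summand_homogeneous[OF in_G[of e a] in_G[of f b] in_G[of g c]]
        by (simp add: fs vs)
    qed
    then show "(\<Sum>fs | length fs = 3. box_summand fs (?us fs vs)) = 0"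
      by (intro sum.neutral) simp
  qed
  finally show ?thesis .
qed

end

end

end

section \<open>The sign twist\<close>

context diff_superalgebra
begin

text \<open>The axioms that carry no sign; precomposition with the parity involution preserves them
  as they stand.\<close>

definition sesqui_bilinear :: "('v \<Rightarrow> 'v \<Rightarrow> 'v poly) \<Rightarrow> bool" where
  "sesqui_bilinear A \<longleftrightarrow>
    ((\<forall>a a' b. A (a + a') b = A a b + A a' b) \<and> (\<forall>a b b'. A a (b + b') = A a b + A a b')) \<and>
    ((\<forall>c a b. A (sc c a) b = map_poly (sc c) (A a b)) \<and> (\<forall>c a b. A a (sc c b) = map_poly (sc c) (A a b))) \<and>
    ((\<forall>a b. A (D a) b = - pCons 0 (A a b)) \<and> (\<forall>a b. A a (D b) = pCons 0 (A a b) + map_poly D (A a b)))"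

definition parity_preserving :: "('v \<Rightarrow> 'v \<Rightarrow> 'v poly) \<Rightarrow> bool" where
  "parity_preserving A \<longleftrightarrow> (\<forall>e f a b n. a \<in> G e \<and> b \<in> G f \<longrightarrow> coeff (A a b) n \<in> G (e + f))"

definition odd_square_zero :: "('v \<Rightarrow> 'v \<Rightarrow> 'v poly) \<Rightarrow> bool" where
  "odd_square_zero A \<longleftrightarrow> sesqui_bilinear A \<and> parity_preserving A \<and>
    (\<forall>e f a b. a \<in> G e \<and> b \<in> G f \<longrightarrow> A b a = sg ((e + 1) * (f + 1)) (flip D (A a b))) \<and>
    (\<forall>e f g a b c. a \<in> G e \<and> b \<in> G f \<and> c \<in> G g \<longrightarrow> jacobi_sum A e f a b c = 0) \<and>
    (\<forall>e f g a b c. a \<in> G e \<and> b \<in> G f \<and> c \<in> G g \<longrightarrow>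
      A a (b * c) = rmult_poly c (A a b) + sg (f * g) (rmult_poly b (A a c)))"

lemma odd_square_zero_iff:
  assumes "X \<in> {vs. length vs = 2} \<rightarrow>\<^sub>E qspace D 2"
  shows "X \<in> W_as sc G D 2 \<and> W_parity (reverse_parity G) 2 1 X \<and>
      W_bracket (reverse_parity G) D 2 1 2 1 X X = W_zero D 3 \<longleftrightarrow> odd_square_zero (at_lam D X)"
proof -
  let ?A = "at_lam D X"
  let ?sym = "\<forall>e f a b. a \<in> G e \<and> b \<in> G f \<longrightarrow> ?A b a = sg ((e + 1) * (f + 1)) (flip D (?A a b))"
  have W: "X \<in> W sc (reverse_parity G) D 2 \<longleftrightarrow> sesqui_bilinear ?A \<and> ?sym"
    unfolding W_iff[OF assms refl] sesqui_bilinear_def by (simp only: conj_assoc)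
  have parity: "W_parity (reverse_parity G) 2 1 X \<longleftrightarrow> parity_preserving ?A"
    unfolding W_parity_iff[OF assms refl] parity_preserving_def ..
  have W_as: "X \<in> W_as sc G D 2 \<longleftrightarrow> X \<in> W sc (reverse_parity G) D 2 \<and>
      (\<forall>e f g a b c. a \<in> G e \<and> b \<in> G f \<and> c \<in> G g \<longrightarrow>
        ?A a (b * c) = rmult_poly c (?A a b) + sg (f * g) (rmult_poly b (?A a c)))"
  proof (cases "X \<in> W sc (reverse_parity G) D 2")
    case True
    then show ?thesis
      by (simp only: W_as_iff[OF assms refl True] simp_thms)
  qed (simp add: W_as_def)
  have bracket: "W_bracket (reverse_parity G) D 2 1 2 1 X X = W_zero D 3 \<longleftrightarrow>
    (\<forall>e f g a b c. a \<in> G e \<and> b \<in> G f \<and> c \<in> G g \<longrightarrow> jacobi_sum ?A e f a b c = 0)"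
    if "sesqui_bilinear ?A" "?sym" "parity_preserving ?A"
  proof (rule W_bracket_iff[OF assms refl])
    note s = that(1)[unfolded sesqui_bilinear_def]
    show "?A (a + a') b = ?A a b + ?A a' b" "?A a (b + b') = ?A a b + ?A a b'"
      "?A (D a) b = - pCons 0 (?A a b)" for a a' b b'
      by (simp_all only: s)
    show "?A b a = sg ((e + 1) * (f + 1)) (flip D (?A a b))" if "a \<in> G e" "b \<in> G f" for e f a b
      using \<open>?sym\<close> that by iprover
    show "coeff (?A a b) n \<in> G (e + f)" if "a \<in> G e" "b \<in> G f" for e f a b n
      using \<open>parity_preserving ?A\<close> that unfolding parity_preserving_def by iprover
  qed
  \<comment> \<open>Purely propositional: the translation of the bracket condition is available only
    under the other conditions, so the equivalences cannot simply be conjoined.\<close>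
  have "\<lbrakk>w \<longleftrightarrow> l \<and> s; p \<longleftrightarrow> p'; as \<longleftrightarrow> w \<and> r; l \<Longrightarrow> s \<Longrightarrow> p' \<Longrightarrow> b \<longleftrightarrow> j\<rbrakk>
      \<Longrightarrow> as \<and> p \<and> b \<longleftrightarrow> l \<and> p' \<and> s \<and> j \<and> r" for w l s p p' as r b j
    by blast
  from this[OF W parity W_as bracket] show ?thesis
    unfolding odd_square_zero_def .
qed

lemma poisson_vertex_superalgebra_iff:
  "poisson_vertex_superalgebra sc G D br \<longleftrightarrow> sesqui_bilinear br \<and> parity_preserving br \<and>
    (\<forall>e f a b. a \<in> G e \<and> b \<in> G f \<longrightarrow> br b a = - sg (e * f) (flip D (br a b))) \<and>
    (\<forall>e f g a b c. a \<in> G e \<and> b \<in> G f \<and> c \<in> G g \<longrightarrow>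
        psubst (lam 1) (\<lambda>v. psubst (lam 0) vconst (br a v)) (br b c)
        - sg (e * f) (psubst (lam 0) (\<lambda>v. psubst (lam 1) vconst (br b v)) (br a c))
        = psubst (lam 0) (\<lambda>v. psubst (\<lambda>Q. lam 0 Q + lam 1 Q) vconst (br v c)) (br a b)) \<and>
    (\<forall>e f g a b c. a \<in> G e \<and> b \<in> G f \<and> c \<in> G g \<longrightarrow>
        br a (b * c) = rmult_poly c (br a b) + sg (e * f) (map_poly (\<lambda>x. b * x) (br a c)))"
  unfolding poisson_vertex_superalgebra_def sesqui_bilinear_def parity_preserving_def flip_def
      rmult_poly_def
  by (simp only: conj_ac)

lemma sesqui_bilinear_par_inv:
  assumes "sesqui_bilinear A"
  shows "sesqui_bilinear (\<lambda>a. A (par_inv G a))"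
proof -
  have "par_inv G (a + b) = par_inv G a + par_inv G b" "par_inv G (sc c a) = sc c (par_inv G a)"
    "par_inv G (D a) = D (par_inv G a)" for a b c
    using additive.add[OF additive_par_inv] par_inv_commute[OF additive_scale scale_in_G]
      par_inv_commute[OF additive_D D_even] by blast+
  with assms show ?thesis
    unfolding sesqui_bilinear_def by metis
qed

text \<open>The sign twist \<open>[a\<^sub>\<lambda> b] = (-1)\<^bsup>p(a)\<^esup> X\<^bsub>\<lambda>,-\<lambda>-\<partial>\<^esub>(a, b)\<close> exchanges the two sets of axioms.\<close>

context
  fixes A br :: "'v \<Rightarrow> 'v \<Rightarrow> 'v poly"
  assumes A: "sesqui_bilinear A"
    and br: "\<And>e a b. a \<in> G e \<Longrightarrow> br a b = sg e (A a b)"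
begin

lemma additive_twist:
  assumes "Modules.additive T"
  shows "Modules.additive (\<lambda>y. psubst T vconst (A y b))" "Modules.additive (\<lambda>y. psubst T vconst (A b y))"
proof -
  note T = additive_psubst[OF assms additive_vconst]
  show "Modules.additive (\<lambda>y. psubst T vconst (A y b))" "Modules.additive (\<lambda>y. psubst T vconst (A b y))"
    by (rule additive_comp[OF T]; use A in \<open>simp add: sesqui_bilinear_def Modules.additive_def\<close>)+
qed

lemma parity_twist: "parity_preserving br \<longleftrightarrow> parity_preserving A"
proof -
  have "coeff (sg e P) n \<in> G f \<longleftrightarrow> coeff P n \<in> G f" for e f P n
    using uminus_in_G[of "coeff P n" f] uminus_in_G[of "- coeff P n" f] by (auto simp: sg_def)
  then have "coeff (br a b) n \<in> G h \<longleftrightarrow> coeff (A a b) n \<in> G h" if "a \<in> G e" for a b e h n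
    using br[OF that] by simp
  then show ?thesis
    unfolding parity_preserving_def by blast
qed

text \<open>The left side contributes f and the right side e; both are absorbed by (e + 1)(f + 1) =
  ef + e + f + 1, and the remaining 1 is the minus sign of skewcommutativity.\<close>

lemma skew_twist:
  assumes "a \<in> G e" "b \<in> G f"
  shows "br b a = - sg (e * f) (flip D (br a b)) \<longleftrightarrow> A b a = sg ((e + 1) * (f + 1)) (flip D (A a b))"
  unfolding br[OF assms(1)] br[OF assms(2)] additive_commutes_sg[OF additive_flip[OF additive_D]]
  by (cases e; cases f; simp)

text \<open>In a nested bracket the twist may depend on the parity of the inner value. All
  coefficients of P have parity p, so that sign is constant and comes out of the
  substitution.\<close>

lemma psubst_twist:
  assumes T: "Modules.additive T" and \<phi>: "Modules.additive \<phi>"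
    and P: "\<And>n. coeff P n \<in> G p" and \<psi>: "\<And>y. y \<in> G p \<Longrightarrow> \<psi> y = sg e (\<phi> y)"
  shows "psubst T \<psi> (sg f P) = sg e (sg f (psubst T \<phi> P))"
proof -
  have "coeff (sg f P) n \<in> G p" for n
    using P[of n] by (simp add: sg_def uminus_in_G)
  then have "psubst T \<psi> (sg f P) = psubst T (\<lambda>y. sg e (\<phi> y)) (sg f P)"
    by (intro psubst_cong \<psi> refl)
  also have "\<dots> = sg e (psubst T \<phi> (sg f P))"
    by (rule psubst_intertwine[symmetric]) (simp_all add: additive_sg additive_commutes_sg[OF T])
  finally show ?thesis
    by (simp only: additive_commutes_sg[OF additive_psubst[OF T \<phi>]])
qed

text \<open>The two terms on the left acquire the exponent e + f, the term on the right (e + f) + e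
  = f, because there the inner bracket is the first argument of the outer one. Multiplying
  \<open>jacobi_sum\<close> by (-1)^f gives the same three signs.\<close>

lemma jacobi_twist:
  assumes "parity_preserving A" and abc: "a \<in> G e" "b \<in> G f" "c \<in> G g"
  shows "psubst (lam 1) (\<lambda>v. psubst (lam 0) vconst (br a v)) (br b c)
        - sg (e * f) (psubst (lam 0) (\<lambda>v. psubst (lam 1) vconst (br b v)) (br a c))
        = psubst (lam 0) (\<lambda>v. psubst (\<lambda>Q. lam 0 Q + lam 1 Q) vconst (br v c)) (br a b)
      \<longleftrightarrow> jacobi_sum A e f a b c = 0"
proof -
  have P: "coeff (A x y) n \<in> G (h + k)" if "x \<in> G h" "y \<in> G k" for x y h k n
    using assms(1) that unfolding parity_preserving_def by blast
  have U: "Modules.additive (\<lambda>Q. lam 0 Q + lam 1 Q :: 'v vpoly)"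
    by (intro additive_plus additive_lam)
  have sg: "psubst T vconst (sg h Q) = sg h (psubst T vconst Q)" if "Modules.additive T" for T h
      and Q :: "'v poly"
    by (rule additive_commutes_sg[OF additive_psubst[OF that additive_vconst]])
  have 1: "psubst (lam 1) (\<lambda>v. psubst (lam 0) vconst (br a v)) (br b c)
      = sg e (sg f (psubst (lam 1) (\<lambda>v. psubst (lam 0) vconst (A a v)) (A b c)))"
    unfolding br[OF abc(2)]
    by (rule psubst_twist[OF additive_lam additive_twist(2)[OF additive_lam] P[OF abc(2,3)]])
      (simp only: br[OF abc(1)] sg[OF additive_lam])
  have 2: "psubst (lam 0) (\<lambda>v. psubst (lam 1) vconst (br b v)) (br a c)
      = sg f (sg e (psubst (lam 0) (\<lambda>v. psubst (lam 1) vconst (A b v)) (A a c)))"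
    unfolding br[OF abc(1)]
    by (rule psubst_twist[OF additive_lam additive_twist(2)[OF additive_lam] P[OF abc(1,3)]])
      (simp only: br[OF abc(2)] sg[OF additive_lam])
  have 3: "psubst (lam 0) (\<lambda>v. psubst (\<lambda>Q. lam 0 Q + lam 1 Q) vconst (br v c)) (br a b)
      = sg (e + f) (sg e (psubst (lam 0) (\<lambda>v. psubst (\<lambda>Q. lam 0 Q + lam 1 Q) vconst (A v c)) (A a b)))"
    unfolding br[OF abc(1)]
    by (rule psubst_twist[OF additive_lam additive_twist(1)[OF U] P[OF abc(1,2)]])
      (simp only: br sg[OF U])
  show ?thesis
    unfolding 1 2 3 jacobi_sum_def
    by (cases e; cases f; simp add: algebra_simps eq_neg_iff_add_eq_0 neg_eq_iff_add_eq_0; metis)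
qed

text \<open>The first argument is a throughout, so the twist is a common sign. Moving b to the right
  of a coefficient of parity e + g costs f(e + g), which together with ef leaves fg.\<close>

lemma leibniz_twist:
  assumes "parity_preserving A" and abc: "a \<in> G e" "b \<in> G f" "c \<in> G g"
  shows "br a (b * c) = rmult_poly c (br a b) + sg (e * f) (map_poly (\<lambda>x. b * x) (br a c))
    \<longleftrightarrow> A a (b * c) = rmult_poly c (A a b) + sg (f * g) (rmult_poly b (A a c))"
proof -
  have "b * coeff (A a c) n = sg (f * (e + g)) (coeff (A a c) n * b)" for n
    using assms by (intro supercommute) (auto simp: parity_preserving_def)
  moreover have "coeff (sg h Q) n = sg h (coeff Q n)" for h n and Q :: "'v poly"
    by (simp add: sg_def)
  ultimately have "map_poly (\<lambda>x. b * x) (A a c) = sg (f * (e + g)) (rmult_poly b (A a c))"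
    by (simp add: poly_eq_iff map_poly_coeff[OF additive_mult_left] rmult_poly_def
        map_poly_coeff[OF additive_mult_right])
  moreover have "- x = - y - z \<longleftrightarrow> x = y + z" "- x = z - y \<longleftrightarrow> x = y - z" for x y z :: "'v poly"
  proof -
    have "- y - z = - (y + z)" "z - y = - (y - z)"
      by simp_all
    then show "- x = - y - z \<longleftrightarrow> x = y + z" "- x = z - y \<longleftrightarrow> x = y - z"
      by (simp_all only: neg_equal_iff_equal)
  qed
  ultimately show ?thesis
    unfolding br[OF abc(1)] additive_commutes_sg[OF additive_rmult_poly]
      additive_commutes_sg[OF additive_map_poly[OF additive_mult_left]]
    by (cases e; cases f; cases g; simp)
qed

end

text \<open>The parity involution is its own inverse, so br and A determine each other in the same
  way and the unsigned axioms transfer in both directions.\<close>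

lemma odd_square_zero_par_inv_iff:
  "poisson_vertex_superalgebra sc G D br \<longleftrightarrow> odd_square_zero (\<lambda>a. br (par_inv G a))"
proof -
  define A where "A = (\<lambda>a. br (par_inv G a))"
  have br: "br = (\<lambda>a. A (par_inv G a))"
    by (simp add: A_def par_inv_par_inv)
  have sesqui: "sesqui_bilinear br \<longleftrightarrow> sesqui_bilinear A"
    using sesqui_bilinear_par_inv[of br] sesqui_bilinear_par_inv[of A]
        by (simp only: flip: A_def br) iprover
  have twist: "br a b = sg e (A a b)" if "sesqui_bilinear A" "a \<in> G e" for a b e
  proof -
    have "Modules.additive (\<lambda>a. A a b)"
      using that(1) by (simp add: sesqui_bilinear_def Modules.additive_def)
    then have "A (sg e a) b = sg e (A a b)"
      by (rule additive_commutes_sg[of "\<lambda>a. A a b"])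
    then show ?thesis
      using par_inv_homogeneous[OF that(2)] by (simp add: br)
  qed
  show ?thesis
  proof (cases "sesqui_bilinear A \<and> parity_preserving A")
    case True
    note t = conjunct1[OF True] twist[OF conjunct1[OF True]]
    have "parity_preserving br"
      using True parity_twist[OF t] by blast
    moreover have "(\<forall>e f a b. a \<in> G e \<and> b \<in> G f \<longrightarrow> br b a = - sg (e * f) (flip D (br a b))) \<longleftrightarrow>
      (\<forall>e f a b. a \<in> G e \<and> b \<in> G f \<longrightarrow> A b a = sg ((e + 1) * (f + 1)) (flip D (A a b)))"
      by (intro iff_allI imp_cong refl; elim conjE; rule skew_twist[OF t])
    moreover have "(\<forall>e f g a b c. a \<in> G e \<and> b \<in> G f \<and> c \<in> G g \<longrightarrow>
        psubst (lam 1) (\<lambda>v. psubst (lam 0) vconst (br a v)) (br b c)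
        - sg (e * f) (psubst (lam 0) (\<lambda>v. psubst (lam 1) vconst (br b v)) (br a c))
        = psubst (lam 0) (\<lambda>v. psubst (\<lambda>Q. lam 0 Q + lam 1 Q) vconst (br v c)) (br a b)) \<longleftrightarrow>
      (\<forall>e f g a b c. a \<in> G e \<and> b \<in> G f \<and> c \<in> G g \<longrightarrow> jacobi_sum A e f a b c = 0)"
      by (intro iff_allI imp_cong refl; elim conjE; rule jacobi_twist[OF t conjunct2[OF True]])
    moreover have "(\<forall>e f g a b c. a \<in> G e \<and> b \<in> G f \<and> c \<in> G g \<longrightarrow>
        br a (b * c) = rmult_poly c (br a b) + sg (e * f) (map_poly (\<lambda>x. b * x) (br a c))) \<longleftrightarrow>
      (\<forall>e f g a b c. a \<in> G e \<and> b \<in> G f \<and> c \<in> G g \<longrightarrow>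
        A a (b * c) = rmult_poly c (A a b) + sg (f * g) (rmult_poly b (A a c)))"
      by (intro iff_allI imp_cong refl; elim conjE; rule leibniz_twist[OF t conjunct2[OF True]])
    ultimately show ?thesis
      unfolding poisson_vertex_superalgebra_iff odd_square_zero_def A_def[symmetric]
      using True by (simp only: sesqui)
  next
    case False
    \<comment> \<open>The sign rule relating br and A needs additivity of A, so the parity transfer
      is conditional; if bilinearity or sesquilinearity fails for A, it fails for br too.\<close>
    have "parity_preserving br \<longleftrightarrow> parity_preserving A" if "sesqui_bilinear A"
      by (rule parity_twist[OF that twist[OF that]])
    with False sesqui have "\<not> (sesqui_bilinear br \<and> parity_preserving br)"
      by blast
    with False show ?thesis
      unfolding poisson_vertex_superalgebra_iff odd_square_zero_def A_def[symmetric] by iprover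
  qed
qed

end

theorem proposition5p2:
  fixes sc :: "'k::field_char_0 \<Rightarrow> 'v::ring \<Rightarrow> 'v"
    and G :: "bit \<Rightarrow> 'v set"
    and u :: 'v
    and D :: "'v \<Rightarrow> 'v"
  assumes "diff_superalgebra sc G u D"
  shows "bij_betw (lambda_bracket G D)
    {X \<in> W_as sc G D 2. W_parity (reverse_parity G) 2 1 X \<and>
       W_bracket (reverse_parity G) D 2 1 2 1 X X = W_zero D 3}
    {br. poisson_vertex_superalgebra sc G D br}" (is "bij_betw _ ?S _")
proof -
  interpret diff_superalgebra sc G u D
    by (rule assms)
  \<comment> \<open>The inverse map: undo the sign by the parity involution, then read the
    polynomial in \<lambda> as a class in two variables.\<close>
  let ?B = "\<lambda>br. of_bilinear (\<lambda>a. br (par_inv G a))"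
  have S: "X \<in> {vs. length vs = 2} \<rightarrow>\<^sub>E qspace D 2" "odd_square_zero (at_lam D X)" if "X \<in> ?S" for X
  proof -
    show *: "X \<in> {vs. length vs = 2} \<rightarrow>\<^sub>E qspace D 2"
    proof -
      have "X \<in> W sc (reverse_parity G) D 2"
        using that by (simp add: W_as_def)
      then show ?thesis
        unfolding W_def mem_Collect_eq by (rule conjunct1)
    qed
    show "odd_square_zero (at_lam D X)"
      using that odd_square_zero_iff[OF *] by blast
  qed
  have S_iff: "X \<in> ?S \<longleftrightarrow> odd_square_zero (at_lam D X)" if "X \<in> {vs. length vs = 2} \<rightarrow>\<^sub>E qspace D 2" for X
    using odd_square_zero_iff[OF that] by blast
  have bracket: "lambda_bracket G D X = (\<lambda>a. at_lam D X (par_inv G a))"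
      if "odd_square_zero (at_lam D X)" for X
  proof (intro ext)
    fix a b
    have "Modules.additive (\<lambda>a. at_lam D X a b)"
      using that by (simp add: odd_square_zero_def sesqui_bilinear_def Modules.additive_def)
    \<comment> \<open>The defining sum over the two homogeneous components of a, with signs, is the
      value at the parity involution of a, by additivity in the first argument.\<close>
    from additive.diff[OF this] show "lambda_bracket G D X a b = at_lam D X (par_inv G a) b"
      by (simp add: lambda_bracket_def sum_UNIV_bit par_inv_def)
  qed
  have at_lam_B: "at_lam D (?B br) = (\<lambda>a. br (par_inv G a))" for br
    by (intro ext) (rule at_lam_of_bilinear)
  show ?thesis
  proof (rule bij_betw_byWitness[where f' = ?B])
    show "\<forall>X\<in>?S. ?B (lambda_bracket G D X) = X"
      using of_bilinear_at_lam[OF S(1) refl] by (simp add: bracket[OF S(2)] par_inv_par_inv)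
    show "\<forall>br\<in>{br. poisson_vertex_superalgebra sc G D br}. lambda_bracket G D (?B br) = br"
    proof
      fix br assume "br \<in> {br. poisson_vertex_superalgebra sc G D br}"
      then have "odd_square_zero (at_lam D (?B br))"
        unfolding at_lam_B by (simp add: odd_square_zero_par_inv_iff)
      from bracket[OF this] show "lambda_bracket G D (?B br) = br"
        by (simp add: at_lam_B par_inv_par_inv)
    qed
    show "lambda_bracket G D ` ?S \<subseteq> {br. poisson_vertex_superalgebra sc G D br}"
    proof (rule image_subsetI)
      fix X assume "X \<in> ?S"
      from S(2)[OF this] show "lambda_bracket G D X \<in> {br. poisson_vertex_superalgebra sc G D br}"
        by (simp add: bracket[OF S(2)[OF \<open>X \<in> ?S\<close>]] odd_square_zero_par_inv_iff par_inv_par_inv)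
    qed
    show "?B ` {br. poisson_vertex_superalgebra sc G D br} \<subseteq> ?S"
    proof (rule image_subsetI)
      fix br assume "br \<in> {br. poisson_vertex_superalgebra sc G D br}"
      then have "odd_square_zero (at_lam D (?B br))"
        unfolding at_lam_B by (simp add: odd_square_zero_par_inv_iff)
      then show "?B br \<in> ?S"
        by (rule S_iff[OF of_bilinear_ext, THEN iffD2])
    qed
  qed
qed

end
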